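(* Let $\mathcal I\subseteq\mathbb Z[y_{ijk}]$ be the ideal generated by, for pairwise distinct $i,j,k,\ell\in[n]_0^\pm$: (i) $y_{ijk}(1-y_{ijk})$; (ii) $y_{ijk}-(1-y_{ikj})$; (iii) $y_{\bar i jk}-y_{i\bar j\bar k}$; (iv) $y_{ijk}-y_{ij\ell}+y_{ik\ell}-y_{jk\ell}$; (v) $y_{ijk}y_{ik\ell}(1-y_{ij\ell})+(1-y_{ijk})(1-y_{ik\ell})y_{ij\ell}$. Then $H^*(\mathcal Y_{n+1}^1;\mathbb Z)\cong\mathbb Z[y_{ijk}]/\mathcal I$, where the variable $y_{ijk}$ corresponds to the signed cyclic Heaviside function $y_{ijk}$. Moreover, the set $\mathcal N$ of monomials obtained by multiplying at most one element from each of the sets $h_m=\{y_{0\bar0m}\}\cup\{y_{0im},y_{0i\bar m}:1\le i<m\}$, $m=1,\dots,n$, is a $\mathbb Z$-basis of $H^*(\mathcal Y_{n+1}^1;\mathbb Z)$.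
   Context: $\mathcal Y_{n+1}^1=\{(p_0,\dots,p_n)\in U(1)^{n+1}:p_i\neq\pm p_j\text{ for } i\ne j\}/U(1)$ (quotient by diagonal multiplication); it is a disjoint union of contractible pieces, so its integral cohomology is the ring of locally constant $\mathbb Z$-valued functions on it. Index set $[n]_0^\pm=\{0,\bar0,1,\bar1,\dots,n,\bar n\}$ with $\bar{\bar i}=i$; set $p_{\bar i}:=-p_i$. For distinct $i,j,k\in[n]_0^\pm$, the signed cyclic Heaviside function $y_{ijk}$ takes value $1$ at a point if $p_i,p_j,p_k$ occur in this counterclockwise cyclic order on $U(1)$, and $0$ otherwise. In the polynomial ring $\mathbb Z[y_{ijk}]$ the variables are indexed by distinct triples in $[n]_0^\pm$ up to cyclic rotation ($y_{ijk}=y_{jki}=y_{kij}$). *)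

theory Defs
  imports
    "HOL-Analysis.Analysis"
    "HOL-Library.Poly_Mapping"
    "HOL-Algebra.QuotRing"
begin

section \<open>The signed index set\<close>

datatype sidx = Plain nat | Bar nat

fun bar :: "sidx \<Rightarrow> sidx" where
  "bar (Plain i) = Bar i"
| "bar (Bar i) = Plain i"

definition sidxs :: "nat \<Rightarrow> sidx set" where
  "sidxs n = Plain ` {..n} \<union> Bar ` {..n}"

definition triples :: "nat \<Rightarrow> (sidx \<times> sidx \<times> sidx) set" where
  "triples n = {(i, j, k). i \<in> sidxs n \<and> j \<in> sidxs n \<and> k \<in> sidxs n \<and> distinct [i, j, k]}"


section \<open>The space\<close>

abbreviation U1 :: "complex set" where
  "U1 \<equiv> sphere 0 1"

definition conf :: "nat \<Rightarrow> (nat \<Rightarrow> complex) set" where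
  "conf n = {p \<in> {..n} \<rightarrow>\<^sub>E U1. \<forall>i\<le>n. \<forall>j\<le>n. i \<noteq> j \<longrightarrow> p i \<noteq> p j \<and> p i \<noteq> - p j}"

definition conf_space :: "nat \<Rightarrow> (nat \<Rightarrow> complex) topology" where
  "conf_space n = subtopology (product_topology (\<lambda>_. top_of_set U1) {..n}) (conf n)"

definition orbit :: "nat \<Rightarrow> (nat \<Rightarrow> complex) \<Rightarrow> (nat \<Rightarrow> complex) set" where
  "orbit n p = {\<lambda>i\<in>{..n}. u * p i | u. u \<in> U1}"

definition quotient_topology :: "'a topology \<Rightarrow> ('a \<Rightarrow> 'b) \<Rightarrow> 'b topology" where
  "quotient_topology X f =
     topology (\<lambda>U. U \<subseteq> f ` topspace X \<and> openin X {x \<in> topspace X. f x \<in> U})"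

definition Y_space :: "nat \<Rightarrow> (nat \<Rightarrow> complex) set topology" where
  "Y_space n = quotient_topology (conf_space n) (orbit n)"

lemma openin_quotient_topology:
  "openin (quotient_topology X f) U \<longleftrightarrow>
     U \<subseteq> f ` topspace X \<and> openin X {x \<in> topspace X. f x \<in> U}"
proof -
  have "istopology (\<lambda>U. U \<subseteq> f ` topspace X \<and> openin X {x \<in> topspace X. f x \<in> U})"
    unfolding istopology_def
  proof (intro conjI allI impI; (elim conjE)?)
    fix S T
    assume "openin X {x \<in> topspace X. f x \<in> S}" "openin X {x \<in> topspace X. f x \<in> T}"
    then have "openin X ({x \<in> topspace X. f x \<in> S} \<inter> {x \<in> topspace X. f x \<in> T})"
      by (rule openin_Int)
    also have "{x \<in> topspace X. f x \<in> S} \<inter> {x \<in> topspace X. f x \<in> T} =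
               {x \<in> topspace X. f x \<in> S \<inter> T}"
      by blast
    finally show "openin X {x \<in> topspace X. f x \<in> S \<inter> T}" .
  next
    fix K
    assume "\<forall>U\<in>K. U \<subseteq> f ` topspace X \<and> openin X {x \<in> topspace X. f x \<in> U}"
    then have "openin X (\<Union>U\<in>K. {x \<in> topspace X. f x \<in> U})"
      by blast
    also have "(\<Union>U\<in>K. {x \<in> topspace X. f x \<in> U}) = {x \<in> topspace X. f x \<in> \<Union>K}"
      by blast
    finally show "openin X {x \<in> topspace X. f x \<in> \<Union>K}" .
  qed blast+
  then show ?thesis
    by (simp add: quotient_topology_def)
qed

lemma topspace_quotient_topology [simp]:
  "topspace (quotient_topology X f) = f ` topspace X"
proof
  show "topspace (quotient_topology X f) \<subseteq> f ` topspace X"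
    by (metis openin_quotient_topology openin_topspace)
  have "{x \<in> topspace X. f x \<in> f ` topspace X} = topspace X"
    by blast
  then have "openin (quotient_topology X f) (f ` topspace X)"
    by (simp add: openin_quotient_topology)
  then show "f ` topspace X \<subseteq> topspace (quotient_topology X f)"
    by (rule openin_subset)
qed

lemma quotient_map_quotient_topology:
  "quotient_map X (quotient_topology X f) f"
  by (simp add: quotient_map_def openin_quotient_topology)

lemma topspace_Y_space: "topspace (Y_space n) = orbit n ` conf n"
proof -
  have "conf n \<subseteq> {..n} \<rightarrow>\<^sub>E U1"
    by (auto simp: conf_def)
  then have "topspace (conf_space n) = conf n"
    by (simp add: conf_space_def Int_absorb1)
  then show ?thesis
    by (simp add: Y_space_def)
qed


section \<open>Integral cohomology\<close>

definition locally_constant :: "'a topology \<Rightarrow> ('a \<Rightarrow> 'b) \<Rightarrow> bool" where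
  "locally_constant X f \<longleftrightarrow>
     (\<forall>x\<in>topspace X. \<exists>U. openin X U \<and> x \<in> U \<and> (\<forall>y\<in>U. f y = f x))"

text \<open>The integral cohomology of a disjoint union of contractible pieces is concentrated
  in degree zero and equals the ring of locally constant integer-valued functions. Functions
  are extensional, so that equality in the ring is equality on the space.\<close>

definition lc_ring :: "'a topology \<Rightarrow> ('a \<Rightarrow> int) ring" where
  "lc_ring X =
     \<lparr>carrier = {f \<in> extensional (topspace X). locally_constant X f},
      mult = (\<lambda>f g. \<lambda>x\<in>topspace X. f x * g x),
      one = (\<lambda>x\<in>topspace X. 1),
      zero = (\<lambda>x\<in>topspace X. 0),
      add = (\<lambda>f g. \<lambda>x\<in>topspace X. f x + g x)\<rparr>"

abbreviation H_Y :: "nat \<Rightarrow> ((nat \<Rightarrow> complex) set \<Rightarrow> int) ring" where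
  "H_Y n \<equiv> lc_ring (Y_space n)"

lemma locally_constant_const: "locally_constant X (\<lambda>x\<in>topspace X. c)"
  unfolding locally_constant_def by (intro ballI exI[of _ "topspace X"]) simp

lemma locally_constant_op:
  assumes "locally_constant X f" "locally_constant X g"
  shows "locally_constant X (\<lambda>x\<in>topspace X. F (f x) (g x))"
  unfolding locally_constant_def
proof
  fix x assume x: "x \<in> topspace X"
  obtain U where U: "openin X U" "x \<in> U" "\<forall>y\<in>U. f y = f x"
    using assms(1) x unfolding locally_constant_def by blast
  obtain V where V: "openin X V" "x \<in> V" "\<forall>y\<in>V. g y = g x"
    using assms(2) x unfolding locally_constant_def by blast
  show "\<exists>W. openin X W \<and> x \<in> W \<and>
          (\<forall>y\<in>W. (\<lambda>x\<in>topspace X. F (f x) (g x)) y = (\<lambda>x\<in>topspace X. F (f x) (g x)) x)"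
  proof (intro exI conjI ballI)
    show "openin X (U \<inter> V)"
      using U(1) V(1) by (rule openin_Int)
    show "x \<in> U \<inter> V"
      using U(2) V(2) by simp
    fix y assume y: "y \<in> U \<inter> V"
    then have "y \<in> topspace X" "f y = f x" "g y = g x"
      using openin_subset[OF U(1)] U(3) V(3) by blast+
    then show "(\<lambda>x\<in>topspace X. F (f x) (g x)) y = (\<lambda>x\<in>topspace X. F (f x) (g x)) x"
      using x by simp
  qed
qed

lemma lc_ring_simps:
  "x \<in> topspace X \<Longrightarrow> (f \<oplus>\<^bsub>lc_ring X\<^esub> g) x = f x + g x"
  "x \<in> topspace X \<Longrightarrow> (f \<otimes>\<^bsub>lc_ring X\<^esub> g) x = f x * g x"
  "x \<in> topspace X \<Longrightarrow> \<one>\<^bsub>lc_ring X\<^esub> x = 1"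
  "x \<in> topspace X \<Longrightarrow> \<zero>\<^bsub>lc_ring X\<^esub> x = 0"
  by (simp_all add: lc_ring_def)

lemma lc_ring_closed:
  "f \<in> carrier (lc_ring X) \<Longrightarrow> g \<in> carrier (lc_ring X) \<Longrightarrow> f \<oplus>\<^bsub>lc_ring X\<^esub> g \<in> carrier (lc_ring X)"
  "f \<in> carrier (lc_ring X) \<Longrightarrow> g \<in> carrier (lc_ring X) \<Longrightarrow> f \<otimes>\<^bsub>lc_ring X\<^esub> g \<in> carrier (lc_ring X)"
  "\<one>\<^bsub>lc_ring X\<^esub> \<in> carrier (lc_ring X)"
  "\<zero>\<^bsub>lc_ring X\<^esub> \<in> carrier (lc_ring X)"
  "f \<in> carrier (lc_ring X) \<Longrightarrow> (\<lambda>x\<in>topspace X. - f x) \<in> carrier (lc_ring X)"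
  using locally_constant_op[of X f f "\<lambda>a b. - a"] locally_constant_op[of X f g "(+)"]
    locally_constant_op[of X f g "(*)"] locally_constant_const[of X]
  by (simp_all add: lc_ring_def)

lemma lc_ring_eqI:
  assumes "f \<in> carrier (lc_ring X)" "g \<in> carrier (lc_ring X)"
    and "\<And>x. x \<in> topspace X \<Longrightarrow> f x = g x"
  shows "f = g"
  using assms by (intro extensionalityI[of f "topspace X" g]) (simp_all add: lc_ring_def)

lemma cring_lc_ring: "cring (lc_ring X)"
proof -
  note cl = lc_ring_closed[where X = X]
  note eq = lc_ring_eqI[where X = X]
  have add_assoc: "f \<oplus>\<^bsub>lc_ring X\<^esub> g \<oplus>\<^bsub>lc_ring X\<^esub> h = f \<oplus>\<^bsub>lc_ring X\<^esub> (g \<oplus>\<^bsub>lc_ring X\<^esub> h)"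
    if "f \<in> carrier (lc_ring X)" "g \<in> carrier (lc_ring X)" "h \<in> carrier (lc_ring X)" for f g h
    by (rule eq) (simp_all add: cl that lc_ring_simps)
  have add_comm: "f \<oplus>\<^bsub>lc_ring X\<^esub> g = g \<oplus>\<^bsub>lc_ring X\<^esub> f"
    if "f \<in> carrier (lc_ring X)" "g \<in> carrier (lc_ring X)" for f g
    by (rule eq) (simp_all add: cl that lc_ring_simps)
  have add_zero: "\<zero>\<^bsub>lc_ring X\<^esub> \<oplus>\<^bsub>lc_ring X\<^esub> f = f" if "f \<in> carrier (lc_ring X)" for f
    by (rule eq) (simp_all add: cl that lc_ring_simps)
  have add_neg: "(\<lambda>x\<in>topspace X. - f x) \<oplus>\<^bsub>lc_ring X\<^esub> f = \<zero>\<^bsub>lc_ring X\<^esub>" if "f \<in> carrier (lc_ring X)" for f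
    by (rule eq) (simp_all add: cl that lc_ring_simps)
  have mult_assoc: "f \<otimes>\<^bsub>lc_ring X\<^esub> g \<otimes>\<^bsub>lc_ring X\<^esub> h = f \<otimes>\<^bsub>lc_ring X\<^esub> (g \<otimes>\<^bsub>lc_ring X\<^esub> h)"
    if "f \<in> carrier (lc_ring X)" "g \<in> carrier (lc_ring X)" "h \<in> carrier (lc_ring X)" for f g h
    by (rule eq) (simp_all add: cl that lc_ring_simps)
  have mult_comm: "f \<otimes>\<^bsub>lc_ring X\<^esub> g = g \<otimes>\<^bsub>lc_ring X\<^esub> f"
    if "f \<in> carrier (lc_ring X)" "g \<in> carrier (lc_ring X)" for f g
    by (rule eq) (simp_all add: cl that lc_ring_simps)
  have mult_one: "\<one>\<^bsub>lc_ring X\<^esub> \<otimes>\<^bsub>lc_ring X\<^esub> f = f" if "f \<in> carrier (lc_ring X)" for f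
    by (rule eq) (simp_all add: cl that lc_ring_simps)
  have distr: "(f \<oplus>\<^bsub>lc_ring X\<^esub> g) \<otimes>\<^bsub>lc_ring X\<^esub> h = f \<otimes>\<^bsub>lc_ring X\<^esub> h \<oplus>\<^bsub>lc_ring X\<^esub> g \<otimes>\<^bsub>lc_ring X\<^esub> h"
    if "f \<in> carrier (lc_ring X)" "g \<in> carrier (lc_ring X)" "h \<in> carrier (lc_ring X)" for f g h
    by (rule eq) (simp_all add: cl that lc_ring_simps distrib_right)
  have "abelian_group (lc_ring X)"
    by (rule abelian_groupI) (fact cl add_assoc add_comm add_zero | blast intro: cl add_neg)+
  moreover have "Group.comm_monoid (lc_ring X)"
    by (rule comm_monoidI) (fact cl mult_assoc mult_comm mult_one)+
  ultimately show ?thesis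
    by (rule cringI) (fact distr)
qed


section \<open>Signed cyclic Heaviside functions\<close>

fun spt :: "(nat \<Rightarrow> complex) \<Rightarrow> sidx \<Rightarrow> complex" where
  "spt p (Plain i) = p i"
| "spt p (Bar i) = - p i"

definition ccw :: "complex \<Rightarrow> complex \<Rightarrow> complex \<Rightarrow> bool" where
  "ccw a b c \<longleftrightarrow> (\<exists>\<alpha> \<beta> \<gamma>. \<alpha> < \<beta> \<and> \<beta> < \<gamma> \<and> \<gamma> < \<alpha> + 2 * pi \<and>
     a = cis \<alpha> \<and> b = cis \<beta> \<and> c = cis \<gamma>)"

text \<open>The value does not depend on the representative of the orbit, see
  \<open>heaviside_orbit\<close> below.\<close>

definition heaviside :: "nat \<Rightarrow> sidx \<Rightarrow> sidx \<Rightarrow> sidx \<Rightarrow> (nat \<Rightarrow> complex) set \<Rightarrow> int" where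
  "heaviside n i j k =
     (\<lambda>P\<in>topspace (Y_space n). if \<exists>p\<in>P. ccw (spt p i) (spt p j) (spt p k) then 1 else 0)"

lemma ccw_rotate_imp:
  assumes "norm u = 1" "ccw a b c"
  shows "ccw (u * a) (u * b) (u * c)"
proof -
  obtain t where t: "u = cis t"
    using rcis_cmod_Arg[of u] assms(1) by (metis cis_rcis_eq)
  obtain \<alpha> \<beta> \<gamma> where "\<alpha> < \<beta>" "\<beta> < \<gamma>" "\<gamma> < \<alpha> + 2 * pi" "a = cis \<alpha>" "b = cis \<beta>" "c = cis \<gamma>"
    using assms(2) unfolding ccw_def by blast
  then show ?thesis
    unfolding ccw_def t
    by (intro exI[of _ "t + \<alpha>"] exI[of _ "t + \<beta>"] exI[of _ "t + \<gamma>"]) (simp add: cis_mult)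
qed

lemma ccw_rotate:
  assumes "norm u = 1"
  shows "ccw (u * a) (u * b) (u * c) \<longleftrightarrow> ccw a b c"
proof
  assume "ccw (u * a) (u * b) (u * c)"
  then have "ccw (inverse u * (u * a)) (inverse u * (u * b)) (inverse u * (u * c))"
    by (rule ccw_rotate_imp[rotated]) (simp add: norm_inverse assms)
  moreover have "inverse u * (u * z) = z" for z
    using assms by (cases "u = 0") (auto simp: field_simps)
  ultimately show "ccw a b c"
    by simp
qed (rule ccw_rotate_imp[OF assms])

lemma heaviside_orbit:
  assumes "p \<in> conf n" "i \<in> sidxs n" "j \<in> sidxs n" "k \<in> sidxs n"
  shows "heaviside n i j k (orbit n p) = (if ccw (spt p i) (spt p j) (spt p k) then 1 else 0)"
proof -
  have *: "spt (\<lambda>i\<in>{..n}. u * p i) s = u * spt p s" if "s \<in> sidxs n" for s u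
    using that by (auto simp: sidxs_def)
  have "(\<exists>q\<in>orbit n p. ccw (spt q i) (spt q j) (spt q k)) \<longleftrightarrow>
        (\<exists>u\<in>U1. ccw (u * spt p i) (u * spt p j) (u * spt p k))"
    unfolding orbit_def using assms(2-4) by (auto simp: * cong: conj_cong) (metis * assms(2-4))
  also have "\<dots> \<longleftrightarrow> (\<exists>u\<in>U1. ccw (spt p i) (spt p j) (spt p k))"
    by (intro bex_cong refl ccw_rotate) simp
  also have "\<dots> \<longleftrightarrow> ccw (spt p i) (spt p j) (spt p k)"
    by (auto intro: exI[of _ 1])
  finally have "(\<exists>q\<in>orbit n p. ccw (spt q i) (spt q j) (spt q k)) \<longleftrightarrow>
        ccw (spt p i) (spt p j) (spt p k)" .
  then show ?thesis
    using assms(1) by (simp add: heaviside_def topspace_Y_space)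
qed


section \<open>The polynomial ring and the ideal of relations\<close>

type_synonym 'v zpoly = "('v \<Rightarrow>\<^sub>0 nat) \<Rightarrow>\<^sub>0 int"

definition zpoly_ring :: "'v set \<Rightarrow> 'v zpoly ring" where
  "zpoly_ring V =
     \<lparr>carrier = {f. \<forall>m\<in>Poly_Mapping.keys f. Poly_Mapping.keys m \<subseteq> V},
      mult = (*), one = 1, zero = 0, add = (+)\<rparr>"

lemma zpoly_ring_simps [simp]:
  "x \<oplus>\<^bsub>zpoly_ring V\<^esub> y = x + y" "x \<otimes>\<^bsub>zpoly_ring V\<^esub> y = x * y"
  "\<one>\<^bsub>zpoly_ring V\<^esub> = 1" "\<zero>\<^bsub>zpoly_ring V\<^esub> = 0"
  by (simp_all add: zpoly_ring_def)

lemma zpoly_ring_closed: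
  shows "0 \<in> carrier (zpoly_ring V)" "1 \<in> carrier (zpoly_ring V)"
    and "f \<in> carrier (zpoly_ring V) \<Longrightarrow> - f \<in> carrier (zpoly_ring V)"
    and "f \<in> carrier (zpoly_ring V) \<Longrightarrow> g \<in> carrier (zpoly_ring V) \<Longrightarrow>
           f + g \<in> carrier (zpoly_ring V)"
    and "f \<in> carrier (zpoly_ring V) \<Longrightarrow> g \<in> carrier (zpoly_ring V) \<Longrightarrow>
           f - g \<in> carrier (zpoly_ring V)"
    and "f \<in> carrier (zpoly_ring V) \<Longrightarrow> g \<in> carrier (zpoly_ring V) \<Longrightarrow>
           f * g \<in> carrier (zpoly_ring V)"
proof -
  show "0 \<in> carrier (zpoly_ring V)" "1 \<in> carrier (zpoly_ring V)"
    by (simp_all add: zpoly_ring_def)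
  show neg: "- f \<in> carrier (zpoly_ring V)" if "f \<in> carrier (zpoly_ring V)" for f :: "'a zpoly"
    using that by (simp add: zpoly_ring_def)
  show add: "f + g \<in> carrier (zpoly_ring V)"
    if "f \<in> carrier (zpoly_ring V)" "g \<in> carrier (zpoly_ring V)" for f g :: "'a zpoly"
    using that Poly_Mapping.keys_add[of f g] by (auto simp: zpoly_ring_def)
  show "f - g \<in> carrier (zpoly_ring V)"
    if "f \<in> carrier (zpoly_ring V)" "g \<in> carrier (zpoly_ring V)"
    using add[OF that(1) neg[OF that(2)]] by simp
  assume fg: "f \<in> carrier (zpoly_ring V)" "g \<in> carrier (zpoly_ring V)"
  have "Poly_Mapping.keys m \<subseteq> V" if m: "m \<in> Poly_Mapping.keys (f * g)" for m
  proof -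
    obtain a b where "a \<in> Poly_Mapping.keys f" "b \<in> Poly_Mapping.keys g" "m = a + b"
      using m keys_mult[of f g] by blast
    then show ?thesis
      using fg Poly_Mapping.keys_add[of a b] by (fastforce simp: zpoly_ring_def)
  qed
  then show "f * g \<in> carrier (zpoly_ring V)"
    by (simp add: zpoly_ring_def)
qed

lemma cring_zpoly_ring: "cring (zpoly_ring V)"
proof (rule cringI)
  show "abelian_group (zpoly_ring V)"
  proof (rule abelian_groupI)
    fix f assume "f \<in> carrier (zpoly_ring V)"
    then show "\<exists>g\<in>carrier (zpoly_ring V). g \<oplus>\<^bsub>zpoly_ring V\<^esub> f = \<zero>\<^bsub>zpoly_ring V\<^esub>"
      by (intro bexI[of _ "- f"]) (simp_all add: zpoly_ring_closed)
  qed (simp_all add: zpoly_ring_closed add_ac)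
  show "Group.comm_monoid (zpoly_ring V)"
    by (rule comm_monoidI) (simp_all add: zpoly_ring_closed mult_ac)
qed (simp add: distrib_right)

text \<open>A variable is named by the rotation class of a triple, whence
  \<open>yv i j k = yv j k i = yv k i j\<close>.\<close>

type_synonym yvar = "(sidx \<times> sidx \<times> sidx) set"

definition cyc :: "sidx \<Rightarrow> sidx \<Rightarrow> sidx \<Rightarrow> yvar" where
  "cyc i j k = {(i, j, k), (j, k, i), (k, i, j)}"

definition yv :: "sidx \<Rightarrow> sidx \<Rightarrow> sidx \<Rightarrow> yvar zpoly" where
  "yv i j k = Poly_Mapping.single (Poly_Mapping.single (cyc i j k) 1) 1"

definition Zy :: "nat \<Rightarrow> yvar zpoly ring" where
  "Zy n = zpoly_ring {cyc i j k | i j k. (i, j, k) \<in> triples n}"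

lemma yv_rotate: "yv i j k = yv j k i"
proof -
  have "cyc i j k = cyc j k i"
    by (auto simp: cyc_def)
  then show ?thesis
    by (simp add: yv_def)
qed

lemma yv_carrier: "(i, j, k) \<in> triples n \<Longrightarrow> yv i j k \<in> carrier (Zy n)"
  by (auto simp: Zy_def zpoly_ring_def yv_def)

text \<open>In the third family, \<open>bar i\<close> may coincide with \<open>j\<close> or \<open>k\<close> even if \<open>i, j, k\<close> are distinct,
  in which case the two symbols in the relation do not denote variables; the membership of
  \<open>(bar i, j, k)\<close> in \<open>triples n\<close> excludes exactly these cases.\<close>

inductive_set relations :: "nat \<Rightarrow> yvar zpoly set" for n :: nat where
  idem: "(i, j, k) \<in> triples n \<Longrightarrow> yv i j k * (1 - yv i j k) \<in> relations n"
| flip: "(i, j, k) \<in> triples n \<Longrightarrow> yv i j k - (1 - yv i k j) \<in> relations n"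
| antipode: "(i, j, k) \<in> triples n \<Longrightarrow> (bar i, j, k) \<in> triples n \<Longrightarrow>
    yv (bar i) j k - yv i (bar j) (bar k) \<in> relations n"
| cocycle: "{i, j, k, l} \<subseteq> sidxs n \<Longrightarrow> distinct [i, j, k, l] \<Longrightarrow>
    yv i j k - yv i j l + yv i k l - yv j k l \<in> relations n"
| transit: "{i, j, k, l} \<subseteq> sidxs n \<Longrightarrow> distinct [i, j, k, l] \<Longrightarrow>
    yv i j k * yv i k l * (1 - yv i j l) + (1 - yv i j k) * (1 - yv i k l) * yv i j l
      \<in> relations n"

definition I_Y :: "nat \<Rightarrow> yvar zpoly set" where
  "I_Y n = Idl\<^bsub>Zy n\<^esub> (relations n)"


section \<open>The monomial basis\<close>

definition hset :: "nat \<Rightarrow> yvar zpoly set" where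
  "hset m = {yv (Plain 0) (Bar 0) (Plain m)} \<union>
     (\<Union>i\<in>{1..<m}. {yv (Plain 0) (Plain i) (Plain m), yv (Plain 0) (Plain i) (Bar m)})"

definition monoms :: "nat \<Rightarrow> yvar zpoly set" where
  "monoms n = {\<Prod>m\<in>M. g m | M g. M \<subseteq> {1..n} \<and> (\<forall>m\<in>M. g m \<in> hset m)}"

definition finite_Z_basis :: "('a, 'b) ring_scheme \<Rightarrow> 'a set \<Rightarrow> bool" where
  "finite_Z_basis R B \<longleftrightarrow> finite B \<and> B \<subseteq> carrier R \<and>
     (\<forall>x\<in>carrier R. \<exists>!c::'a \<Rightarrow> int. c \<in> extensional B \<and> x = (\<Oplus>\<^bsub>R\<^esub>b\<in>B. [c b] \<cdot>\<^bsub>R\<^esub> b))"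

lemma relations_carrier: "relations n \<subseteq> carrier (Zy n)"
proof
  note cl = zpoly_ring_closed[where V = "{cyc i j k | i j k. (i, j, k) \<in> triples n}", folded Zy_def]
  have bar_bar: "bar (bar s) = s" for s
    by (cases s) auto
  have bar_in: "s \<in> sidxs n \<Longrightarrow> bar s \<in> sidxs n" for s
    by (auto simp: sidxs_def)
  fix x assume "x \<in> relations n"
  then show "x \<in> carrier (Zy n)"
  proof cases
    case (idem i j k)
    then show ?thesis by (simp add: cl yv_carrier)
  next
    case (flip i j k)
    then have "(i, k, j) \<in> triples n"
      by (auto simp: triples_def)
    with flip show ?thesis by (simp add: cl yv_carrier)
  next
    case (antipode i j k)
    have "(i, bar j, bar k) \<in> triples n"
      using antipode(2,3) bar_in[of j] bar_in[of k] bar_bar[of i] bar_bar[of j] bar_bar[of k]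
      unfolding triples_def by (simp, metis)
    with antipode show ?thesis by (simp add: cl yv_carrier)
  next
    case (cocycle i j k l)
    then have "(i, j, k) \<in> triples n" "(i, j, l) \<in> triples n" "(i, k, l) \<in> triples n"
      "(j, k, l) \<in> triples n"
      by (simp_all add: triples_def)
    with cocycle show ?thesis by (simp add: cl yv_carrier)
  next
    case (transit i j k l)
    then have "(i, j, k) \<in> triples n" "(i, j, l) \<in> triples n" "(i, k, l) \<in> triples n"
      by (simp_all add: triples_def)
    with transit show ?thesis by (simp add: cl yv_carrier)
  qed
qed

lemma ideal_I_Y: "ideal (I_Y n) (Zy n)"
proof -
  interpret cring "Zy n"
    unfolding Zy_def by (rule cring_zpoly_ring)
  show ?thesis
    unfolding I_Y_def by (rule genideal_ideal[OF relations_carrier])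
qed

end

theory Submission
  imports Defs
begin

text \<open>
  Evaluation of the variables at the Heaviside functions kills the relations, because these are
  identities between cyclic orders of points of the circle. It is onto: two configurations with the
  same pattern of cyclic orders, normalised to \<open>p\<^sub>0 = 1\<close>, are joined by linear interpolation of the
  angles, so a locally constant function depends on the pattern only, and the indicator function
  of a pattern is a product of factors \<open>y\<close> and \<open>1 - y\<close>.

  Modulo the ideal, let \<open>A\<^sub>m\<close> be the subring generated by the variables with indices up to \<open>m\<close>. The
  linear relations write the variables of \<open>A\<^sub>m\<close>, up to 2-torsion for the one with indices \<open>0, m, -m\<close>,
  in terms of the \<open>y\<^sub>0\<^sub>k\<^sub>m\<close>. The last relation removes the torsion, and otherwise
  becomes \<open>y\<^sub>0\<^sub>i\<^sub>m y\<^sub>0\<^sub>j\<^sub>m = y\<^sub>0\<^sub>i\<^sub>j y\<^sub>0\<^sub>j\<^sub>m + (1 - y\<^sub>0\<^sub>i\<^sub>j) y\<^sub>0\<^sub>i\<^sub>m\<close>; hence \<open>A\<^sub>m\<close> is spanned over \<open>A\<^sub>m\<^sub>-\<^sub>1\<close>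
  by \<open>1\<close> and \<open>h\<^sub>m\<close>, and the quotient is spanned over the integers by the monomials.

  The monomials are linearly independent as functions: fix \<open>p\<^sub>0, \<dots>, p\<^sub>m\<^sub>-\<^sub>1\<close> and let \<open>p\<^sub>m\<close> pass through
  one of the points \<open>\<plusminus>p\<^sub>i\<close>. Away from \<open>\<plusminus>p\<^sub>0\<close> exactly one element of \<open>h\<^sub>m\<close> jumps, so its coefficient
  vanishes; the passage through \<open>-p\<^sub>0\<close> then isolates \<open>y\<close> with indices \<open>0, -0, m\<close>. So the monomials
  are a basis, and the kernel of the evaluation is the ideal.
\<close>

section \<open>Cyclic order on the circle\<close>

text \<open>Twice the signed area of the triangle \<open>a\<close>, \<open>b\<close>,
  \<open>c\<close>. Being polynomial in the real coordinates, it turns cyclic order on the circle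
  into an open condition.\<close>

definition orient :: "complex \<Rightarrow> complex \<Rightarrow> complex \<Rightarrow> real" where
  "orient a b c = Im (cnj (b - a) * (c - a))"

text \<open>In half differences of the angles the area becomes a product of sines, so that its sign
  can be read off from the ranges of three factors.\<close>

lemma orient_cis:
  "orient (cis \<alpha>) (cis \<beta>) (cis \<gamma>) = 4 * sin ((\<beta> - \<alpha>) / 2) * sin ((\<gamma> - \<beta>) / 2) * sin ((\<gamma> - \<alpha>) / 2)"
proof -
  define x where "x = (\<beta> - \<alpha>) / 2"
  define y where "y = (\<gamma> - \<beta>) / 2"
  have xy: "(\<gamma> - \<alpha>) / 2 = x + y" "\<beta> - \<alpha> = 2 * x" "\<gamma> - \<beta> = 2 * y" "\<gamma> - \<alpha> = 2 * x + 2 * y"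
    by (simp_all add: x_def y_def field_simps)
  have "orient (cis \<alpha>) (cis \<beta>) (cis \<gamma>) = sin (\<beta> - \<alpha>) + sin (\<gamma> - \<beta>) - sin (\<gamma> - \<alpha>)"
    by (simp add: orient_def sin_diff algebra_simps)
  also have "\<dots> = sin (2 * x) * (1 - cos (2 * y)) + sin (2 * y) * (1 - cos (2 * x))"
    by (simp add: xy sin_add algebra_simps)
  also have "\<dots> = 4 * sin x * sin y * sin (x + y)"
    unfolding sin_double cos_double_sin sin_add by (simp add: algebra_simps power2_eq_square)
  finally show ?thesis
    by (simp only: xy(1) x_def[symmetric] y_def[symmetric])
qed

text \<open>Lifted angles of a counterclockwise triple have half differences in (0, pi), where the
  sine is positive.\<close>

lemma ccw_imp_orient: 
  assumes "ccw a b c" shows "0 < orient a b c"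
proof -
  obtain \<alpha> \<beta> \<gamma> where "\<alpha> < \<beta>" "\<beta> < \<gamma>" "\<gamma> < \<alpha> + 2 * pi" "a = cis \<alpha>" "b = cis \<beta>" "c = cis \<gamma>"
    using assms unfolding ccw_def by blast
  then show ?thesis
    by (auto simp: orient_cis intro!: mult_pos_pos sin_gt_zero)
qed

lemma orient_swap: "orient a c b = - orient a b c"
  by (simp add: orient_def algebra_simps)

lemma ccw_asym: "ccw a b c \<Longrightarrow> \<not> ccw a c b"
  using ccw_imp_orient[of a b c] ccw_imp_orient[of a c b] orient_swap[of a b c] by auto

lemma ccw_distinct: "ccw a b c \<Longrightarrow> a \<noteq> b \<and> b \<noteq> c \<and> a \<noteq> c"
  using ccw_imp_orient[of a b c] by (auto simp: orient_def algebra_simps)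

lemma ccw_cis_less:
  assumes "\<alpha> < \<beta>" "\<beta> < \<gamma>" "\<gamma> < \<alpha> + 2 * pi"
  shows "ccw (cis \<alpha>) (cis \<beta>) (cis \<gamma>)"
  using assms unfolding ccw_def by blast

lemma ccw_cycle_imp: "ccw a b c \<Longrightarrow> ccw b c a"
proof -
  assume "ccw a b c"
  then obtain \<alpha> \<beta> \<gamma> where "\<alpha> < \<beta>" "\<beta> < \<gamma>" "\<gamma> < \<alpha> + 2 * pi" "a = cis \<alpha>" "b = cis \<beta>" "c = cis \<gamma>"
    unfolding ccw_def by blast
  moreover have "cis (\<alpha> + 2 * pi) = cis \<alpha>"
    by (simp flip: cis_mult)
  ultimately show ?thesis
    using ccw_cis_less[of \<beta> \<gamma> "\<alpha> + 2 * pi"] by simp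
qed

lemma ccw_cycle: "ccw b c a \<longleftrightarrow> ccw a b c"
  using ccw_cycle_imp[of a b c] ccw_cycle_imp[of b c a] ccw_cycle_imp[of c a b] by argo

lemma cis_Arg2pi: "a \<in> U1 \<Longrightarrow> cis (Arg2pi a) = a"
  using complex_norm_eq_1_exp[of a] by (simp add: cis_conv_exp)

lemma Arg2pi_U1_eq_iff: "a \<in> U1 \<Longrightarrow> b \<in> U1 \<Longrightarrow> Arg2pi a = Arg2pi b \<longleftrightarrow> a = b"
  by (metis cis_Arg2pi)

text \<open>Increasing arguments are angle lifts, and rotation covers the other two ways to cut the
  circle. Conversely, the arguments of distinct points are in one of the two cyclic orders, and
  \<open>ccw_asym\<close> excludes the wrong one.\<close>

lemma ccw_iff_Arg2pi:
  assumes "a \<in> U1" "b \<in> U1" "c \<in> U1"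
  shows "ccw a b c \<longleftrightarrow> Arg2pi a < Arg2pi b \<and> Arg2pi b < Arg2pi c \<or>
    Arg2pi b < Arg2pi c \<and> Arg2pi c < Arg2pi a \<or> Arg2pi c < Arg2pi a \<and> Arg2pi a < Arg2pi b"
    (is "_ \<longleftrightarrow> ?R a b c")
proof -
  have imp: "ccw x y z" if "x \<in> U1" "y \<in> U1" "z \<in> U1" "Arg2pi x < Arg2pi y" "Arg2pi y < Arg2pi z" for x y z
    using ccw_cis_less[of "Arg2pi x" "Arg2pi y" "Arg2pi z"] that cis_Arg2pi Arg2pi[of x] Arg2pi[of z]
    by simp
  have R: "ccw x y z" if "x \<in> U1" "y \<in> U1" "z \<in> U1" "?R x y z" for x y z
    using that imp[of x y z] imp[of y z x] imp[of z x y] ccw_cycle[of x y z] ccw_cycle[of y z x] ccw_cycle[of z x y]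
    by argo
  show ?thesis
  proof
    assume ccw: "ccw a b c"
    have "Arg2pi a \<noteq> Arg2pi b" "Arg2pi b \<noteq> Arg2pi c" "Arg2pi a \<noteq> Arg2pi c"
      using ccw_distinct[OF ccw] assms by (simp_all add: Arg2pi_U1_eq_iff)
    moreover have "\<not> ?R a c b"
      using R[of a c b] ccw_asym[OF ccw] assms by blast
    ultimately show "?R a b c"
      by linarith
  qed (use R assms in blast)
qed

lemma ccw_1_iff:
  assumes "b \<in> U1" "c \<in> U1"
  shows "ccw 1 b c \<longleftrightarrow> 0 < Arg2pi b \<and> Arg2pi b < Arg2pi c"
proof -
  have "Arg2pi 1 = 0"
    using Arg2pi_of_real[of 1] by simp
  then show ?thesis
    using ccw_iff_Arg2pi[of 1 b c] assms Arg2pi[of b] Arg2pi[of c] by auto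
qed

lemma ccw_total:
  assumes "a \<in> U1" "b \<in> U1" "c \<in> U1" "a \<noteq> b" "b \<noteq> c" "a \<noteq> c"
  shows "ccw a c b \<longleftrightarrow> \<not> ccw a b c"
proof -
  have "Arg2pi a \<noteq> Arg2pi b" "Arg2pi b \<noteq> Arg2pi c" "Arg2pi a \<noteq> Arg2pi c"
    using assms by (simp_all add: Arg2pi_U1_eq_iff)
  then show ?thesis
    unfolding ccw_iff_Arg2pi[OF assms(1-3)] ccw_iff_Arg2pi[OF assms(1,3,2)] by argo
qed

text \<open>Positive area forces the points to be distinct and excludes the opposite order;
  \<open>ccw_total\<close> leaves only one possibility.\<close>

lemma ccw_iff_orient:
  assumes "a \<in> U1" "b \<in> U1" "c \<in> U1"
  shows "ccw a b c \<longleftrightarrow> 0 < orient a b c"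
proof
  assume o: "0 < orient a b c"
  then have "\<not> ccw a c b"
    using ccw_imp_orient[of a c b] orient_swap[of a b c] by auto
  moreover have "a \<noteq> b \<and> b \<noteq> c \<and> a \<noteq> c"
    using o by (auto simp: orient_def algebra_simps)
  ultimately show "ccw a b c"
    using ccw_total[of a b c] assms by blast
qed (rule ccw_imp_orient)

lemma ccw_uminus: "ccw (- a) (- b) (- c) \<longleftrightarrow> ccw a b c"
  using ccw_rotate[of "- 1" a b c] by simp

lemma eventually_ccw:
  assumes "a \<in> U1" "b \<in> U1" "w \<in> U1" "ccw a b w"
    and "(f \<longlongrightarrow> w) F" "eventually (\<lambda>x. f x \<in> U1) F"
  shows "eventually (\<lambda>x. ccw a b (f x)) F"
proof -
  have "((\<lambda>x. orient a b (f x)) \<longlongrightarrow> orient a b w) F"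
    unfolding orient_def by (intro tendsto_intros assms)
  then have "eventually (\<lambda>x. 0 < orient a b (f x)) F"
    using ccw_imp_orient[OF assms(4)] order_tendstoD(1) by blast
  then show ?thesis
    using assms(6) by eventually_elim (use assms(1,2) in \<open>simp add: ccw_iff_orient\<close>)
qed

text \<open>For three distinct points both the order and its opposite are open conditions, so
  neither truth value can change near \<open>w\<close>.\<close>

lemma eventually_ccw_iff:
  assumes "a \<in> U1" "b \<in> U1" "w \<in> U1" "a \<noteq> b" "a \<noteq> w" "b \<noteq> w"
    and lim: "(f \<longlongrightarrow> w) F" and U: "eventually (\<lambda>x. f x \<in> U1) F"
  shows "eventually (\<lambda>x. ccw a b (f x) \<longleftrightarrow> ccw a b w) F"
proof (cases "ccw a b w")
  case True
  show ?thesis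
    using eventually_ccw[OF assms(1-3) True lim U] by eventually_elim (simp add: True)
next
  case False
  then have "ccw b a w"
    using ccw_total[of a b w] assms(1-6) ccw_cycle[of a w b] ccw_cycle[of b a w] by simp
  then have "eventually (\<lambda>x. ccw b a (f x)) F"
    using eventually_ccw[OF assms(2,1,3) _ lim U] by blast
  then show ?thesis
    by eventually_elim (metis False ccw_asym ccw_cycle_imp)
qed

section \<open>Evaluation of polynomials at configurations\<close>

lemma poly_mapping_keys_induct:
  fixes f :: "'a \<Rightarrow>\<^sub>0 'b::comm_monoid_add"
  assumes "Poly_Mapping.keys f \<subseteq> V" and zero: "P 0"
    and single: "\<And>k c. k \<in> V \<Longrightarrow> P (Poly_Mapping.single k c)"
    and add: "\<And>f g. P f \<Longrightarrow> P g \<Longrightarrow> P (f + g)"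
  shows "P f"
proof -
  have "f = (\<Sum>k\<in>Poly_Mapping.keys f. Poly_Mapping.single k (Poly_Mapping.lookup f k))"
    by (rule poly_mapping_eqI)
      (auto simp: lookup_sum lookup_single when_def in_keys_iff)
  moreover have "P (\<Sum>k\<in>K. Poly_Mapping.single k (Poly_Mapping.lookup f k))" if "finite K" "K \<subseteq> V" for K
    using that by (induction K rule: finite_induct) (simp_all add: zero single add)
  ultimately show ?thesis
    using assms(1) by (metis finite_keys)
qed

text \<open>Two inductions are nested: a polynomial is a sum of terms, and a monomial is a product
  of powers of variables, where a power is treated by induction on the exponent.\<close>

lemma zpoly_ring_induct [consumes 1, case_names const var add mult]:
  assumes "f \<in> carrier (zpoly_ring V)"
    and const: "\<And>c. P (of_int c)"
    and var: "\<And>x. x \<in> V \<Longrightarrow> P (Poly_Mapping.single (Poly_Mapping.single x 1) 1)"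
    and add: "\<And>f g. P f \<Longrightarrow> P g \<Longrightarrow> P (f + g)"
    and mult: "\<And>f g. P f \<Longrightarrow> P g \<Longrightarrow> P (f * g)"
  shows "P f"
proof (rule poly_mapping_keys_induct[where P = P and V = "{m. Poly_Mapping.keys m \<subseteq> V}"])
  show "P 0"
    using const[of 0] by simp
  fix m :: "'a \<Rightarrow>\<^sub>0 nat" and c :: int
  assume "m \<in> {m. Poly_Mapping.keys m \<subseteq> V}"
  then have "Poly_Mapping.keys m \<subseteq> V"
    by simp
  then have "P (Poly_Mapping.single m 1)"
  proof (rule poly_mapping_keys_induct[where P = "\<lambda>m. P (Poly_Mapping.single m 1)"])
    show "P (Poly_Mapping.single 0 1)"
      using const[of 1] by simp
    show "P (Poly_Mapping.single (Poly_Mapping.single x k) 1)" if "x \<in> V" for x k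
    proof (induction k)
      case 0
      then show ?case using const[of 1] by simp
    next
      case (Suc k)
      have "Poly_Mapping.single (Poly_Mapping.single x (Suc k)) 1 =
        Poly_Mapping.single (Poly_Mapping.single x 1) 1 * Poly_Mapping.single (Poly_Mapping.single x k) (1::int)"
        by (simp add: mult_single flip: single_add)
      then show ?case using mult[OF var[OF that] Suc] by simp
    qed
    show "P (Poly_Mapping.single (a + b) 1)"
      if "P (Poly_Mapping.single a 1)" "P (Poly_Mapping.single b 1)" for a b
      using mult[OF that] by (simp add: mult_single)
  qed
  from mult[OF const[of c] this] show "P (Poly_Mapping.single m c)"
    by (simp add: mult_single flip: single_of_int)
qed (use assms(1) add in \<open>auto simp: zpoly_ring_def\<close>)

definition meval :: "('v \<Rightarrow> int) \<Rightarrow> ('v \<Rightarrow>\<^sub>0 nat) \<Rightarrow> int" where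
  "meval v m = (\<Prod>x\<in>Poly_Mapping.keys m. v x ^ Poly_Mapping.lookup m x)"

definition peval :: "('v \<Rightarrow> int) \<Rightarrow> 'v zpoly \<Rightarrow> int" where
  "peval v f = (\<Sum>m\<in>Poly_Mapping.keys f. Poly_Mapping.lookup f m * meval v m)"

lemma meval_add: "meval v (a + b) = meval v a * meval v b"
proof -
  \<comment> \<open>Enlarging the index set only adds factors with exponent zero, so all three
    monomials can be evaluated over one common set.\<close>
  have *: "meval v m = (\<Prod>x\<in>K. v x ^ Poly_Mapping.lookup m x)"
    if "finite K" "Poly_Mapping.keys m \<subseteq> K" for m K
    unfolding meval_def using that by (intro prod.mono_neutral_left) (auto simp: in_keys_iff)
  let ?K = "Poly_Mapping.keys a \<union> Poly_Mapping.keys b"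
  show ?thesis
    by (simp add: *[of ?K] Poly_Mapping.keys_add lookup_add power_add prod.distrib)
qed

lemma peval_add: "peval v (f + g) = peval v f + peval v g"
proof -
  have *: "peval v h = (\<Sum>m\<in>K. Poly_Mapping.lookup h m * meval v m)"
    if "finite K" "Poly_Mapping.keys h \<subseteq> K" for h K
    unfolding peval_def using that by (intro sum.mono_neutral_left) (auto simp: in_keys_iff)
  let ?K = "Poly_Mapping.keys f \<union> Poly_Mapping.keys g"
  show ?thesis
    by (simp add: *[of ?K] Poly_Mapping.keys_add lookup_add distrib_right sum.distrib)
qed

lemma peval_single: "peval v (Poly_Mapping.single m c) = c * meval v m"
  by (simp add: peval_def)

lemma peval_0 [simp]: "peval v 0 = 0"
  by (simp add: peval_def)

lemma peval_mult: "peval v (f * g) = peval v f * peval v g"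
proof (induction f rule: poly_mapping_keys_induct[of _ UNIV, case_names sub zero single add])
  case (single m c)
  show ?case
    by (induction g rule: poly_mapping_keys_induct[of _ UNIV, case_names sub zero single add])
      (simp_all add: peval_single mult_single meval_add peval_add distrib_left)
qed (simp_all add: peval_add distrib_right)

lemma peval_of_int [simp]: "peval v (of_int c) = c"
proof -
  have "of_int c = (Poly_Mapping.single 0 c :: ('a \<Rightarrow>\<^sub>0 nat) \<Rightarrow>\<^sub>0 int)"
    by (simp flip: single_of_int)
  then show ?thesis
    by (simp add: peval_single meval_def)
qed

lemma peval_1 [simp]: "peval v 1 = 1"
  using peval_of_int[of v 1] by simp

lemma peval_diff: "peval v (f - g) = peval v f - peval v g"
  using peval_add[of v "f - g" g] by simp

lemma peval_sum: "peval v (\<Sum>x\<in>A. f x) = (\<Sum>x\<in>A. peval v (f x))"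
  by (induction A rule: infinite_finite_induct) (simp_all add: peval_add)

lemma peval_prod: "peval v (\<Prod>x\<in>A. f x) = (\<Prod>x\<in>A. peval v (f x))"
  by (induction A rule: infinite_finite_induct) (simp_all add: peval_mult)

lemma peval_cong:
  assumes "f \<in> carrier (zpoly_ring V)" "\<And>x. x \<in> V \<Longrightarrow> v x = w x"
  shows "peval v f = peval w f"
  unfolding peval_def meval_def
  using assms by (intro sum.cong prod.cong arg_cong2[of _ _ _ _ "(*)"] refl) (auto simp: zpoly_ring_def, metis subsetD)

text \<open>A variable is a rotation class of triples; as \<open>ccw\<close> is invariant under
  rotation of its arguments, any one member decides the value.\<close>

definition ccw_val :: "(nat \<Rightarrow> complex) \<Rightarrow> yvar \<Rightarrow> int" where
  "ccw_val p x = (if \<exists>(i, j, k)\<in>x. ccw (spt p i) (spt p j) (spt p k) then 1 else 0)"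

definition eval_at :: "(nat \<Rightarrow> complex) \<Rightarrow> yvar zpoly \<Rightarrow> int" where
  "eval_at p = peval (ccw_val p)"

lemma eval_at_simps [simp]:
  "eval_at p (f + g) = eval_at p f + eval_at p g" "eval_at p (f - g) = eval_at p f - eval_at p g"
  "eval_at p (f * g) = eval_at p f * eval_at p g"
  "eval_at p 0 = 0" "eval_at p 1 = 1" "eval_at p (of_int c) = c"
  "eval_at p (\<Sum>x\<in>A. F x) = (\<Sum>x\<in>A. eval_at p (F x))" "eval_at p (\<Prod>x\<in>A. F x) = (\<Prod>x\<in>A. eval_at p (F x))"
  by (simp_all add: eval_at_def peval_add peval_diff peval_mult peval_sum peval_prod)

lemma ccw_val_cyc: "ccw_val p (cyc i j k) = of_bool (ccw (spt p i) (spt p j) (spt p k))"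
  using ccw_cycle[of "spt p i" "spt p j" "spt p k"] ccw_cycle[of "spt p k" "spt p i" "spt p j"]
  by (auto simp: ccw_val_def cyc_def)

lemma eval_at_yv: "eval_at p (yv i j k) = of_bool (ccw (spt p i) (spt p j) (spt p k))"
  by (simp add: eval_at_def yv_def peval_single meval_def ccw_val_cyc)

section \<open>Signed indices and the points they name\<close>

lemma bar_bar [simp]: "bar (bar s) = s"
  by (cases s) auto

lemma bar_in_sidxs [simp]: "bar s \<in> sidxs n \<longleftrightarrow> s \<in> sidxs n"
  by (cases s) (auto simp: sidxs_def)

lemma Plain_in_sidxs [simp]: "Plain i \<in> sidxs n \<longleftrightarrow> i \<le> n"
  and Bar_in_sidxs [simp]: "Bar i \<in> sidxs n \<longleftrightarrow> i \<le> n"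
  by (auto simp: sidxs_def)

lemma finite_sidxs [simp]: "finite (sidxs n)"
  by (simp add: sidxs_def)

lemma finite_triples: "finite (triples n)"
  by (rule finite_subset[of _ "sidxs n \<times> sidxs n \<times> sidxs n"]) (auto simp: triples_def)

lemma spt_bar [simp]: "spt p (bar s) = - spt p s"
  by (cases s) auto

lemma spt_in_U1: "p \<in> conf n \<Longrightarrow> s \<in> sidxs n \<Longrightarrow> spt p s \<in> U1"
  by (cases s) (auto simp: conf_def PiE_iff)

text \<open>The definition of a configuration compares different indices only; \<open>p i\<close>
  and \<open>- p i\<close> differ because \<open>p i\<close> is nonzero.\<close>

lemma spt_inj:
  assumes "p \<in> conf n" "s \<in> sidxs n" "t \<in> sidxs n" "s \<noteq> t"
  shows "spt p s \<noteq> spt p t"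
proof -
  have p: "p i \<noteq> p j \<and> p i \<noteq> - p j" if "i \<le> n" "j \<le> n" "i \<noteq> j" for i j
    using assms(1) that by (auto simp: conf_def)
  have "p i \<noteq> - p i" if "i \<le> n" for i
    using spt_in_U1[OF assms(1), of "Plain i"] that by (auto simp: eq_neg_iff_add_eq_0 simp flip: mult_2)
  with p have q: "p i \<noteq> - p j" if "i \<le> n" "j \<le> n" for i j
    using that by (cases "i = j") simp_all
  have "- p i \<noteq> p j" if "i \<le> n" "j \<le> n" for i j
    using q[OF that(2,1)] by auto
  with p q show ?thesis
    using assms(2-4) by (cases s; cases t) auto
qed

section \<open>Cyclic order seen from one of the points\<close>

lemma ccw_rel_Arg2pi:
  assumes "a \<in> U1" "b \<in> U1" "c \<in> U1"
  shows "ccw a b c \<longleftrightarrow> 0 < Arg2pi (b / a) \<and> Arg2pi (b / a) < Arg2pi (c / a)"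
proof -
  have "ccw a b c \<longleftrightarrow> ccw (inverse a * a) (inverse a * b) (inverse a * c)"
    using assms by (subst ccw_rotate) (auto simp: norm_inverse)
  also have "\<dots> \<longleftrightarrow> ccw 1 (b / a) (c / a)"
    using assms by (auto simp: field_simps)
  finally show ?thesis
    using assms by (simp add: ccw_1_iff norm_divide)
qed

text \<open>Rotating \<open>a\<close> to 1 turns the cyclic order seen from \<open>a\<close> into
  the linear order of the numbers \<open>x\<close>, and that of \<open>b\<close>, \<open>c\<close>,
  \<open>d\<close> into the cyclic order of these numbers. What remains is a finite case check for
  three distinct reals.\<close>

lemma ccw_cocycle:
  assumes "a \<in> U1" "b \<in> U1" "c \<in> U1" "d \<in> U1" "distinct [a, b, c, d]"
  shows "of_bool (ccw a b c) - of_bool (ccw a b d) + of_bool (ccw a c d) = (of_bool (ccw b c d) :: int)"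
    and "ccw a b c \<Longrightarrow> ccw a c d \<Longrightarrow> ccw a b d"
    and "ccw a b d \<Longrightarrow> ccw a b c \<or> ccw a c d"
proof -
  define x where "x z = Arg2pi (z / a)" for z
  have U: "b / a \<in> U1" "c / a \<in> U1" "d / a \<in> U1" 
    using assms(1-4) by (simp_all add: norm_divide)
  have ne: "a \<noteq> 0" "b \<noteq> 0" "c \<noteq> 0" "d \<noteq> 0" using assms by auto
  have x: "x b \<noteq> x c" "x b \<noteq> x d" "x c \<noteq> x d"
    using U assms(5) ne by (auto simp: x_def Arg2pi_U1_eq_iff)
  have pos: "0 < x z" if "z \<in> U1" "z \<noteq> a" for z
  proof -
    have "z / a \<in> U1" "z / a \<noteq> 1" using that assms(1) by (auto simp: norm_divide)
    then have "x z \<noteq> Arg2pi 1" unfolding x_def by (subst Arg2pi_U1_eq_iff) auto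
    moreover have "Arg2pi 1 = 0"
      using Arg2pi_of_real[of 1] by simp
    ultimately show ?thesis using Arg2pi[of "z / a"] by (simp add: x_def)
  qed
  have r: "ccw a u v \<longleftrightarrow> x u < x v" if "u \<in> U1" "v \<in> U1" "u \<noteq> a" for u v
    using ccw_rel_Arg2pi[OF assms(1) that(1,2)] pos[OF that(1,3)] by (simp add: x_def)
  have b: "ccw b c d \<longleftrightarrow> x b < x c \<and> x c < x d \<or> x c < x d \<and> x d < x b \<or> x d < x b \<and> x b < x c"
  proof -
    have "ccw b c d \<longleftrightarrow> ccw (inverse a * b) (inverse a * c) (inverse a * d)"
      using assms by (subst ccw_rotate) (auto simp: norm_inverse)
    then show ?thesis
      using ccw_iff_Arg2pi[OF U] by (simp add: x_def field_simps)
  qed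
  have d: "b \<noteq> a" "c \<noteq> a" using assms(5) by auto
  note r = r[OF assms(2,3) d(1)] r[OF assms(2,4) d(1)] r[OF assms(3,4) d(2)]
  show "of_bool (ccw a b c) - of_bool (ccw a b d) + of_bool (ccw a c d) = (of_bool (ccw b c d) :: int)"
    unfolding r b using x by (auto simp: of_bool_def)
  show "ccw a b c \<Longrightarrow> ccw a c d \<Longrightarrow> ccw a b d" "ccw a b d \<Longrightarrow> ccw a b c \<or> ccw a c d"
    unfolding r using x by auto
qed

text \<open>Idempotency reflects the values 0 and 1, the flip is totality of the cyclic order, and
  the antipodal relation is invariance under the half turn. The two four-point families come from
  \<open>ccw_cocycle\<close>.\<close>

lemma eval_at_relations:
  assumes "p \<in> conf n" "r \<in> relations n"
  shows "eval_at p r = 0"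
  using assms(2)
proof cases
  case (flip i j k)
  have "ccw (spt p i) (spt p k) (spt p j) \<longleftrightarrow> \<not> ccw (spt p i) (spt p j) (spt p k)"
    using flip(2) assms(1) by (intro ccw_total) (auto simp: triples_def spt_in_U1[simplified] dest: spt_inj)
  then show ?thesis
    by (simp add: flip(1) eval_at_yv)
next
  case (antipode i j k)
  then show ?thesis
    using ccw_uminus[of "spt p i" "- spt p j" "- spt p k"] by (simp add: eval_at_yv)
next
  case (cocycle i j k l)
  then have "distinct [spt p i, spt p j, spt p k, spt p l]"
    by (auto dest: spt_inj[OF assms(1)])
  then show ?thesis
    using ccw_cocycle(1)[of "spt p i" "spt p j" "spt p k" "spt p l"] spt_in_U1[OF assms(1)] cocycle
    by (simp add: eval_at_yv)
next
  case (transit i j k l)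
  then have "distinct [spt p i, spt p j, spt p k, spt p l]"
    by (auto dest: spt_inj[OF assms(1)])
  then show ?thesis
    using ccw_cocycle(2,3)[of "spt p i" "spt p j" "spt p k" "spt p l"] spt_in_U1[OF assms(1)] transit
    by (auto simp: eval_at_yv)
qed (simp add: eval_at_yv)

section \<open>Spanning modulo the ideal of relations\<close>

text \<open>Coefficients form a subset of the ambient ring, so that successive extensions can be
  nested. Adding one term at a time provides an induction principle for linear combinations.\<close>

inductive_set module_span :: "'a::comm_ring_1 set \<Rightarrow> 'a set \<Rightarrow> 'a set" for R G where
  zero: "0 \<in> module_span R G"
| step: "r \<in> R \<Longrightarrow> g \<in> G \<Longrightarrow> x \<in> module_span R G \<Longrightarrow> r * g + x \<in> module_span R G"

definition is_subring :: "'a::comm_ring_1 set \<Rightarrow> bool" where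
  "is_subring R \<longleftrightarrow> 1 \<in> R \<and> (\<forall>x\<in>R. \<forall>y\<in>R. x - y \<in> R \<and> x * y \<in> R)"

lemma is_subring_closed:
  assumes "is_subring R"
  shows "0 \<in> R" "1 \<in> R" "x \<in> R \<Longrightarrow> - x \<in> R" "x \<in> R \<Longrightarrow> y \<in> R \<Longrightarrow> x - y \<in> R"
    "x \<in> R \<Longrightarrow> y \<in> R \<Longrightarrow> x + y \<in> R" "x \<in> R \<Longrightarrow> y \<in> R \<Longrightarrow> x * y \<in> R"
proof -
  have *: "\<And>x y. x \<in> R \<Longrightarrow> y \<in> R \<Longrightarrow> x - y \<in> R" and one: "1 \<in> R"
    and mult: "x \<in> R \<Longrightarrow> y \<in> R \<Longrightarrow> x * y \<in> R"
    using assms by (auto simp: is_subring_def)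
  show zero: "0 \<in> R"
    using *[OF one one] by simp
  have uminus: "- x \<in> R" if "x \<in> R" for x
    using *[OF zero that] by simp
  then show "x \<in> R \<Longrightarrow> - x \<in> R" .
  show "x \<in> R \<Longrightarrow> y \<in> R \<Longrightarrow> x + y \<in> R"
    using *[of x "- y"] uminus[of y] by simp
qed (use assms in \<open>auto simp: is_subring_def\<close>)

lemma module_span_add:
  assumes "x \<in> module_span R G" "y \<in> module_span R G"
  shows "x + y \<in> module_span R G"
  using assms by (induction x) (auto simp: add.assoc intro: module_span.intros)

lemma module_span_scale:
  assumes "is_subring R" "r \<in> R" "x \<in> module_span R G"
  shows "r * x \<in> module_span R G"
  using assms(3)
proof induction
  case (step s g x)
  then show ?case
    using module_span.step[of "r * s" R g G "r * x"] assms by (simp add: algebra_simps is_subring_closed)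
qed (simp add: module_span.zero)

lemma module_span_diff:
  assumes "is_subring R" "x \<in> module_span R G" "y \<in> module_span R G"
  shows "x - y \<in> module_span R G"
  using module_span_add[OF assms(2) module_span_scale[OF assms(1) _ assms(3), of "-1"]] is_subring_closed[OF assms(1)] by simp

lemma module_span_base: "is_subring R \<Longrightarrow> g \<in> G \<Longrightarrow> g \<in> module_span R G"
  using module_span.step[of 1 R g G 0] by (simp add: module_span.zero is_subring_closed)

lemma module_span_coeff: "r \<in> R \<Longrightarrow> 1 \<in> G \<Longrightarrow> r \<in> module_span R G"
  using module_span.step[of r R 1 G 0] by (simp add: module_span.zero)

lemma module_span_least:
  assumes "is_subring R" "G \<subseteq> module_span R H"
  shows "module_span R G \<subseteq> module_span R H"
proof
  fix x assume "x \<in> module_span R G"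
  then show "x \<in> module_span R H"
    by induction (use assms in \<open>auto intro: module_span_add module_span_scale module_span.zero\<close>)
qed

text \<open>Products need checking on generators only: first a generator times a combination, then a
  combination times a combination, each by induction on one factor.\<close>

lemma is_subring_module_span:
  assumes R: "is_subring R" and "1 \<in> G" and GG: "\<And>g h. g \<in> G \<Longrightarrow> h \<in> G \<Longrightarrow> g * h \<in> module_span R G"
  shows "is_subring (module_span R G)"
proof -
  have g: "g * x \<in> module_span R G" if "g \<in> G" "x \<in> module_span R G" for g x
    using that(2)
  proof induction
    case (step r h x)
    then show ?case
      using module_span_add[OF module_span_scale[OF R step(1) GG[OF that(1) step(2)]] step(4)]
      by (simp add: algebra_simps)
  qed (simp add: module_span.zero)
  have "x * y \<in> module_span R G" if "x \<in> module_span R G" "y \<in> module_span R G" for x y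
    using that(1)
  proof induction
    case (step r h x)
    then show ?case
      using module_span_add[OF module_span_scale[OF R step(1) g[OF step(2) that(2)]] step(4)]
      by (simp add: algebra_simps)
  qed (simp add: module_span.zero)
  then show ?thesis
    using module_span_base[OF R assms(2)] module_span_diff[OF R] by (auto simp: is_subring_def)
qed

section \<open>Congruence modulo the ideal of relations\<close>

lemma Zy_simps [simp]:
  "x \<oplus>\<^bsub>Zy n\<^esub> y = x + y" "x \<otimes>\<^bsub>Zy n\<^esub> y = x * y" "\<one>\<^bsub>Zy n\<^esub> = 1" "\<zero>\<^bsub>Zy n\<^esub> = 0"
  by (simp_all add: Zy_def)

lemma cring_Zy: "cring (Zy n)"
  unfolding Zy_def by (rule cring_zpoly_ring)

lemmas Zy_closed = zpoly_ring_closed[where V = "{cyc i j k | i j k. (i, j, k) \<in> triples n}", folded Zy_def]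
  for n

lemma of_int_Zy: "of_int c \<in> carrier (Zy n)"
proof -
  have "of_int c = (Poly_Mapping.single 0 c :: yvar zpoly)"
    by (simp flip: single_of_int)
  then show ?thesis
    by (simp add: Zy_def zpoly_ring_def)
qed

lemma I_Y_closed:
  shows "0 \<in> I_Y n" "a \<in> I_Y n \<Longrightarrow> a \<in> carrier (Zy n)"
    and "a \<in> I_Y n \<Longrightarrow> b \<in> I_Y n \<Longrightarrow> a + b \<in> I_Y n"
    and "a \<in> I_Y n \<Longrightarrow> c \<in> carrier (Zy n) \<Longrightarrow> c * a \<in> I_Y n"
    and "a \<in> I_Y n \<Longrightarrow> - a \<in> I_Y n" "a \<in> I_Y n \<Longrightarrow> b \<in> I_Y n \<Longrightarrow> a - b \<in> I_Y n"
proof -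
  interpret ideal "I_Y n" "Zy n" by (rule ideal_I_Y)
  note as = ideal.axioms(1)[OF ideal_I_Y[of n]]
  show "0 \<in> I_Y n" using additive_subgroup.zero_closed[OF as] by simp
  show "a \<in> I_Y n \<Longrightarrow> a \<in> carrier (Zy n)" by (rule Icarr)
  show add: "a \<in> I_Y n \<Longrightarrow> b \<in> I_Y n \<Longrightarrow> a + b \<in> I_Y n" for a b
    using additive_subgroup.a_closed[OF as, of a b] by simp
  show mult: "a \<in> I_Y n \<Longrightarrow> c \<in> carrier (Zy n) \<Longrightarrow> c * a \<in> I_Y n" for a c
    using I_l_closed[of a c] by simp
  show minus: "a \<in> I_Y n \<Longrightarrow> - a \<in> I_Y n" for a
    using mult[of a "- 1"] by (simp add: Zy_closed)
  show "a \<in> I_Y n \<Longrightarrow> b \<in> I_Y n \<Longrightarrow> a - b \<in> I_Y n"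
    using add[OF _ minus, of a b] by simp
qed

lemma relations_I_Y: "r \<in> relations n \<Longrightarrow> r \<in> I_Y n"
proof -
  interpret cring "Zy n" by (rule cring_Zy)
  show "r \<in> relations n \<Longrightarrow> r \<in> I_Y n"
    unfolding I_Y_def using genideal_self[OF relations_carrier] by blast
qed

text \<open>Equality of residue classes, with no demand that \<open>a\<close> and \<open>b\<close>
  lie in the ring themselves; compatibility with products therefore asks for carrier
  conditions.\<close>

definition I_cong :: "nat \<Rightarrow> yvar zpoly \<Rightarrow> yvar zpoly \<Rightarrow> bool" where
  "I_cong n a b \<longleftrightarrow> a - b \<in> I_Y n"

lemma I_cong_0_iff: "I_cong n 0 a \<longleftrightarrow> a \<in> I_Y n"
  using I_Y_closed(5)[of a n] I_Y_closed(5)[of "- a" n] by (auto simp: I_cong_def)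

lemma I_cong_refl: "I_cong n a a"
  by (simp add: I_cong_def I_Y_closed)

lemma I_cong_trans [trans]: "I_cong n a b \<Longrightarrow> I_cong n b c \<Longrightarrow> I_cong n a c"
  unfolding I_cong_def by (drule (1) I_Y_closed(3)) simp

lemma I_cong_add: "I_cong n a b \<Longrightarrow> I_cong n c d \<Longrightarrow> I_cong n (a + c) (b + d)"
  unfolding I_cong_def by (drule (1) I_Y_closed(3)) (simp add: algebra_simps)

lemma I_cong_diff: "I_cong n a b \<Longrightarrow> I_cong n c d \<Longrightarrow> I_cong n (a - c) (b - d)"
  unfolding I_cong_def by (drule (1) I_Y_closed(6)) (simp add: algebra_simps)

lemma I_cong_mult:
  assumes "I_cong n a b" "I_cong n c d" "a \<in> carrier (Zy n)" "d \<in> carrier (Zy n)"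
  shows "I_cong n (a * c) (b * d)"
proof -
  have "a * (c - d) + d * (a - b) \<in> I_Y n"
    using assms by (auto simp: I_cong_def intro: I_Y_closed)
  then show ?thesis
    by (simp add: I_cong_def algebra_simps)
qed

lemma I_cong_scale:
  assumes "I_cong n a b" "c \<in> carrier (Zy n)"
  shows "I_cong n (c * a) (c * b)"
  using I_Y_closed(4)[of "a - b" n c] assms by (simp add: I_cong_def algebra_simps)

lemma bar_eq_iff [simp]: "bar s = bar t \<longleftrightarrow> s = t"
  by (metis bar_bar)

lemma triples_rotate: "(i, j, k) \<in> triples n \<Longrightarrow> (j, k, i) \<in> triples n"
  by (auto simp: triples_def)

lemma I_cong_flip: "(i, j, k) \<in> triples n \<Longrightarrow> I_cong n (yv i j k) (1 - yv i k j)"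
  unfolding I_cong_def by (intro relations_I_Y relations.flip)

lemma I_cong_cocycle:
  assumes "{i, j, k, l} \<subseteq> sidxs n" "distinct [i, j, k, l]"
  shows "I_cong n (yv j k l) (yv i j k - yv i j l + yv i k l)"
  using I_Y_closed(5)[OF relations_I_Y[OF relations.cocycle[OF assms]]]
  by (simp add: I_cong_def algebra_simps)

text \<open>The generator, taken at the antipode of an index, negates all three indices, provided
  that this antipode is not among the other two. Three distinct indices contain at most one
  antipodal pair, so some index qualifies, and rotation brings it to the front.\<close>

lemma I_cong_antipode:
  assumes "(i, j, k) \<in> triples n"
  shows "I_cong n (yv i j k) (yv (bar i) (bar j) (bar k))"
proof -
  have *: "I_cong n (yv a b c) (yv (bar a) (bar b) (bar c))"
    if "(a, b, c) \<in> triples n" "bar a \<noteq> b" "bar a \<noteq> c" for a b c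
    using relations.antipode[of "bar a" b c n] that
    unfolding I_cong_def by (intro relations_I_Y) (auto simp: triples_def)
  have "bar i \<noteq> j \<and> bar i \<noteq> k \<or> bar j \<noteq> k \<and> bar j \<noteq> i \<or> bar k \<noteq> i \<and> bar k \<noteq> j"
    using assms bar_bar by (auto simp: triples_def)
  then show ?thesis
    using *[of i j k] *[of j k i] *[of k i j] assms triples_rotate yv_rotate by metis
qed

text \<open>The cubic terms of the transitivity relation cancel. Seen from \<open>i\<close>, both
  \<open>j\<close> and \<open>k\<close> precede \<open>l\<close> exactly when the later one does,
  and \<open>yv i j k\<close> decides which is later.\<close>

lemma I_cong_mult_transit:
  assumes "{i, j, k, l} \<subseteq> sidxs n" "distinct [i, j, k, l]"
  shows "I_cong n (yv i j l * yv i k l) (yv i j k * yv i k l + (1 - yv i j k) * yv i j l)"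
  using I_Y_closed(5)[OF relations_I_Y[OF relations.transit[OF assms]]]
  by (simp add: I_cong_def algebra_simps)

text \<open>The half turn moves \<open>Bar m\<close> to \<open>Plain m\<close> and exchanges
  \<open>Plain 0\<close> with \<open>Bar 0\<close>; a flip undoes this exchange.\<close>

lemma I_cong_bar0_barm:
  assumes "1 \<le> m" "m \<le> n"
  shows "I_cong n (yv (Plain 0) (Bar 0) (Bar m)) (1 - yv (Plain 0) (Bar 0) (Plain m))"
proof -
  have "I_cong n (yv (Plain 0) (Bar 0) (Bar m)) (yv (Bar 0) (Plain 0) (Plain m))"
    using I_cong_antipode[of "Plain 0" "Bar 0" "Bar m" n] assms by (simp add: triples_def)
  also have "I_cong n \<dots> (1 - yv (Bar 0) (Plain m) (Plain 0))"
    using assms by (intro I_cong_flip) (simp add: triples_def)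
  finally show ?thesis
    by (simp add: yv_rotate[of "Plain 0" "Bar 0" "Plain m"])
qed

text \<open>The linear relations only give twice this congruence; transitivity removes the torsion.\<close>

lemma I_cong_m_barm:
  assumes "1 \<le> m" "m \<le> n"
  shows "I_cong n (yv (Plain 0) (Plain m) (Bar m)) (1 - yv (Plain 0) (Bar 0) (Plain m))"
proof -
  define x where "x = yv (Plain 0) (Bar 0) (Plain m)"
  define z where "z = yv (Plain 0) (Plain m) (Bar m)"
  define u where "u = yv (Plain 0) (Plain m) (Bar 0)"
  define v where "v = yv (Plain 0) (Bar 0) (Bar m)"
  have car: "x \<in> carrier (Zy n)" "z \<in> carrier (Zy n)" "u \<in> carrier (Zy n)" "v \<in> carrier (Zy n)"
    unfolding x_def z_def u_def v_def using assms by (auto intro!: yv_carrier simp: triples_def)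
  have two: "2 \<in> carrier (Zy n)"
    using of_int_Zy[of 2] by simp
  have u: "I_cong n u (1 - x)"
    unfolding u_def x_def using assms by (intro I_cong_flip) (simp add: triples_def)
  have v: "I_cong n v (1 - x)"
    unfolding v_def x_def using assms by (rule I_cong_bar0_barm)
  have xx: "x * (1 - x) \<in> I_Y n"
    unfolding x_def using assms by (intro relations_I_Y relations.idem) (simp add: triples_def)
  \<comment> \<open>Transitivity seen from 0 for the points \<open>m\<close>, \<open>-0\<close>,
    \<open>-m\<close>. Both \<open>u\<close> and \<open>v\<close> can then be replaced by
    \<open>1 - x\<close>.\<close>
  have "u * v * (1 - z) + (1 - u) * (1 - v) * z \<in> I_Y n"
    unfolding u_def v_def z_def using assms by (intro relations_I_Y relations.transit) auto
  then have "I_cong n 0 (u * v * (1 - z) + (1 - u) * (1 - v) * z)"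
    by (simp add: I_cong_0_iff)
  also have "I_cong n \<dots> ((1 - x) * (1 - x) * (1 - z) + (1 - (1 - x)) * (1 - (1 - x)) * z)"
    using u v car by (intro I_cong_add I_cong_mult I_cong_diff I_cong_refl Zy_closed)
  finally have "(1 - x) * (1 - x) * (1 - z) + x * x * z \<in> I_Y n"
    by (simp add: I_cong_0_iff)
  from I_Y_closed(3)[OF this xx] have s: "1 - x - z + 2 * (x * z) \<in> I_Y n"
    by (simp add: algebra_simps)
  \<comment> \<open>Multiplication by \<open>x\<close>, with \<open>x * x\<close> reduced to
    \<open>x\<close>, turns the element \<open>s\<close> into \<open>x * z\<close>. Removing
    \<open>2 * (x * z)\<close> from \<open>s\<close> then leaves \<open>1 - x - z\<close>, so no
    division by 2 occurs.\<close>
  have "x * (1 - x - z + 2 * (x * z)) - (x * (1 - x)) + (2 * z) * (x * (1 - x)) \<in> I_Y n"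
    by (rule I_Y_closed(3)[OF I_Y_closed(6)[OF I_Y_closed(4)[OF s car(1)] xx] I_Y_closed(4)[OF xx]])
      (rule Zy_closed(6)[OF two car(2)])
  then have xz: "x * z \<in> I_Y n"
    by (simp add: algebra_simps)
  have "- (1 - x - z + 2 * (x * z)) + 2 * (x * z) \<in> I_Y n"
    by (rule I_Y_closed(3)[OF I_Y_closed(5)[OF s] I_Y_closed(4)[OF xz two]])
  then show ?thesis
    by (simp add: I_cong_def x_def[symmetric] z_def[symmetric] algebra_simps)
qed

text \<open>The chain of subrings A_m. The ideal is put into stage 0, so that membership in every
  stage can be tested modulo the ideal.\<close>

fun span_upto :: "nat \<Rightarrow> nat \<Rightarrow> yvar zpoly set" where
  "span_upto n 0 = {of_int c + x | c x. x \<in> I_Y n}"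
| "span_upto n (Suc m) = module_span (span_upto n m) (insert 1 (hset (Suc m)))"

lemma is_subring_span_upto_0: "is_subring (span_upto n 0)"
proof -
  have intro: "of_int c + x \<in> span_upto n 0" if "x \<in> I_Y n" for c x
    using that by auto
  have "1 \<in> span_upto n 0"
    using intro[OF I_Y_closed(1), of 1] by simp
  moreover have "f - g \<in> span_upto n 0 \<and> f * g \<in> span_upto n 0" if mem: "f \<in> span_upto n 0" "g \<in> span_upto n 0" for f g
  proof -
    obtain c x d y where fg: "f = of_int c + x" "g = of_int d + y" and xy: "x \<in> I_Y n" "y \<in> I_Y n"
      using mem by auto
    have "f - g = of_int (c - d) + (x - y)"
      "f * g = of_int (c * d) + (of_int c * y + (of_int d * x + x * y))"
      by (simp_all add: fg algebra_simps)
    moreover have "of_int c * y + (of_int d * x + x * y) \<in> I_Y n"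
      using xy by (intro I_Y_closed(3,4) of_int_Zy) (auto intro: I_Y_closed(2))
    ultimately show ?thesis
      using intro I_Y_closed(6)[OF xy] by metis
  qed
  ultimately show ?thesis
    by (simp add: is_subring_def)
qed

text \<open>Lets a variable be replaced by a congruent expression whenever membership in a span is
  to be shown.\<close>

lemma I_cong_mem:
  assumes "I_cong n a b" "b \<in> T" "I_Y n \<subseteq> T" "\<And>x y. x \<in> T \<Longrightarrow> y \<in> T \<Longrightarrow> x + y \<in> T"
  shows "a \<in> T"
proof -
  have "b + (a - b) \<in> T"
    using assms(1-3) by (intro assms(4)) (auto simp: I_cong_def)
  then show ?thesis by simp
qed

text \<open>The span of \<open>hset M\<close> and 1 is compared with the span of \<open>W\<close>,
  in which every variable ends in \<open>Plain M\<close>. The two agree, by a half turn followed by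
  the cocycle relation. Products are easy in the second form, since transitivity applies directly,
  so the span is a subring; the remaining variables are reached through the base index 0.\<close>

lemma span_upto_step:
  fixes m :: nat
  defines "M \<equiv> Suc m"
  assumes M: "M \<le> n" and R: "is_subring R" and I: "I_Y n \<subseteq> R"
    and yR: "\<And>i j k. (i, j, k) \<in> triples m \<Longrightarrow> yv i j k \<in> R"
  shows "is_subring (module_span R (insert 1 (hset M)))"
    and "(i, j, k) \<in> triples M \<Longrightarrow> yv i j k \<in> module_span R (insert 1 (hset M))"
proof -
  define W where "W = insert 1 ((\<lambda>k. yv (Plain 0) k (Plain M)) ` (sidxs m - {Plain 0}))"
  let ?T = "module_span R (insert 1 (hset M))" and ?T' = "module_span R W"
  have RT: "R \<subseteq> ?T" "R \<subseteq> ?T'"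
    by (auto simp: W_def intro: module_span_coeff)
  then have IT: "I_Y n \<subseteq> ?T" "I_Y n \<subseteq> ?T'"
    using I by auto
  note memT = I_cong_mem[OF _ _ IT(1) module_span_add] and memT' = I_cong_mem[OF _ _ IT(2) module_span_add]
  have sub: "s \<in> sidxs M" "s \<in> sidxs n" if "s \<in> sidxs m" for s
    using that M unfolding M_def sidxs_def by auto
  have MM: "s \<noteq> Plain M" "s \<noteq> Bar M" if "s \<in> sidxs m" for s
    using that by (auto simp: M_def sidxs_def)
  have one: "1 \<in> R"
    using R by (rule is_subring_closed)
  have h0: "yv (Plain 0) (Bar 0) (Plain M) \<in> ?T"
    by (rule module_span_base[OF R]) (simp add: hset_def)
  have h0': "yv (Plain 0) (Bar 0) (Bar M) \<in> ?T"
    by (rule memT[OF I_cong_bar0_barm]) (use M h0 one RT R in \<open>auto simp: M_def intro!: module_span_diff\<close>)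
  have hi: "yv (Plain 0) (Plain i) (Plain M) \<in> ?T" "yv (Plain 0) (Plain i) (Bar M) \<in> ?T"
    if "1 \<le> i" "i \<le> m" for i
  proof -
    have "yv (Plain 0) (Plain i) (Plain M) \<in> hset M" "yv (Plain 0) (Plain i) (Bar M) \<in> hset M"
      unfolding hset_def using that by (intro UnI2 UN_I[of i]; simp add: M_def)+
    then show "yv (Plain 0) (Plain i) (Plain M) \<in> ?T" "yv (Plain 0) (Plain i) (Bar M) \<in> ?T"
      by (auto intro: module_span_base[OF R])
  qed
  \<comment> \<open>The half turn carries the base index 0 to its antipode, and the cocycle relation
    with 0 added brings it back. The sign of \<open>s\<close> is thereby traded for the sign of
    \<open>k\<close>, up to two variables containing both 0 and -0.\<close>
  have turn: "I_cong n (yv (Plain 0) k s)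
      (yv (Plain 0) (Bar 0) (bar k) - yv (Plain 0) (Bar 0) (bar s) + yv (Plain 0) (bar k) (bar s))"
    if "k \<in> sidxs m - {Plain 0, Bar 0}" "s \<in> {Plain M, Bar M}" for k s
  proof -
    have "I_cong n (yv (Plain 0) k s) (yv (Bar 0) (bar k) (bar s))"
      using I_cong_antipode[of "Plain 0" k s n] that sub[of k] MM[of k] M by (auto simp: triples_def M_def)
    also have "I_cong n \<dots> (yv (Plain 0) (Bar 0) (bar k) - yv (Plain 0) (Bar 0) (bar s) + yv (Plain 0) (bar k) (bar s))"
      using that sub[of k] MM[of "bar k"] M
      by (intro I_cong_cocycle) (auto simp: M_def, (metis bar.simps bar_bar)+)
    finally show ?thesis .
  qed
  have y00: "yv (Plain 0) (Bar 0) k \<in> R" if "k \<in> sidxs m - {Plain 0, Bar 0}" for k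
    using that by (intro yR) (auto simp: triples_def)
  have w: "yv (Plain 0) k (Plain M) \<in> ?T \<and> yv (Plain 0) k (Bar M) \<in> ?T"
    if k: "k \<in> sidxs m - {Plain 0}" for k
  proof (cases k)
    case (Plain i)
    then show ?thesis
      using hi[of i] k by auto
  next
    case (Bar i)
    show ?thesis
    proof (cases "i = 0")
      case True
      then show ?thesis using Bar h0 h0' by simp
    next
      case False
      then have "k \<in> sidxs m - {Plain 0, Bar 0}" "bar k \<in> sidxs m - {Plain 0, Bar 0}"
        using k Bar by auto
      then show ?thesis
        using memT[OF turn[of k "Plain M"]] memT[OF turn[of k "Bar M"]] h0 h0' hi[of i] RT(1) y00[of "bar k"] Bar False
        by (auto intro!: module_span_add module_span_diff[OF R])
    qed
  qed
  have T'T: "?T' \<subseteq> ?T"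
    using w by (intro module_span_least[OF R]) (auto simp: W_def intro: module_span_base[OF R])
  have w': "yv (Plain 0) k (Plain M) \<in> ?T'" if "k \<in> sidxs m - {Plain 0}" for k
    using that by (intro module_span_base[OF R]) (auto simp: W_def)
  \<comment> \<open>Now the trade goes the other way, from \<open>Bar M\<close> to
    \<open>Bar i\<close>.\<close>
  have "yv (Plain 0) (Plain i) (Bar M) \<in> ?T'" if "1 \<le> i" "i \<le> m" for i
    using memT'[OF turn[of "Plain i" "Bar M"]] w'[of "Bar 0"] w'[of "Bar i"] RT(2) y00[of "Bar i"] that
    by (auto intro!: module_span_add module_span_diff[OF R])
  then have "insert 1 (hset M) \<subseteq> ?T'"
    using w'[of "Bar 0"] w' one RT(2) by (auto simp: hset_def M_def)
  then have TT': "?T = ?T'"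
    using T'T module_span_least[OF R] by blast
  have "is_subring ?T'"
  proof (rule is_subring_module_span[OF R])
    fix g h assume gh: "g \<in> W" "h \<in> W"
    have "g * h \<in> ?T'" if "g = 1 \<or> h = 1"
      using that gh module_span_base[OF R] by auto
    \<comment> \<open>Equal factors reduce by idempotency. For distinct factors transitivity leaves
      a linear expression whose coefficients involve only \<open>yv (Plain 0) a b\<close>, an
      element of \<open>R\<close>.\<close>
    moreover have "yv (Plain 0) a (Plain M) * yv (Plain 0) b (Plain M) \<in> ?T'"
      if ab: "a \<in> sidxs m - {Plain 0}" "b \<in> sidxs m - {Plain 0}" for a b
    proof (cases "a = b")
      case True
      have "(Plain 0, a, Plain M) \<in> triples n"
        using ab sub[of a] MM[of a] M by (auto simp: triples_def M_def)
      from relations_I_Y[OF relations.idem[OF this]]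
      have "I_cong n (yv (Plain 0) a (Plain M) * yv (Plain 0) a (Plain M)) (yv (Plain 0) a (Plain M))"
        unfolding I_cong_def by (drule_tac I_Y_closed(5)) (simp add: algebra_simps)
      then show ?thesis
        using memT' w'[of a] ab True by blast
    next
      case False
      have "I_cong n (yv (Plain 0) a (Plain M) * yv (Plain 0) b (Plain M))
        (yv (Plain 0) a b * yv (Plain 0) b (Plain M) + (1 - yv (Plain 0) a b) * yv (Plain 0) a (Plain M))"
        using ab sub[of a] sub[of b] MM[of a] MM[of b] M False by (intro I_cong_mult_transit) (auto simp: M_def)
      moreover have y: "yv (Plain 0) a b \<in> R"
        using ab False by (intro yR) (auto simp: triples_def)
      ultimately show ?thesis
        using module_span_add[OF module_span_scale[OF R y w'[OF ab(2)]]
            module_span_scale[OF R is_subring_closed(4)[OF R one y] w'[OF ab(1)]]] memT' by blast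
    qed
    ultimately show "g * h \<in> ?T'"
      using gh by (auto simp: W_def)
  qed (simp add: W_def)
  then show T: "is_subring ?T"
    by (simp add: TT')
  have flip: "yv a b c \<in> ?T" if "(a, b, c) \<in> triples M" "yv a c b \<in> ?T" for a b c
  proof (rule memT[OF I_cong_flip])
    show "(a, b, c) \<in> triples n"
      using that(1) M by (auto simp: triples_def sidxs_def)
  qed (use that is_subring_closed[OF T] in auto)
  have sM: "s \<in> sidxs m \<or> s = Plain M \<or> s = Bar M" if "s \<in> sidxs M" for s
    using that by (cases s) (auto simp: M_def le_Suc_eq)
  have mM: "yv (Plain 0) (Plain M) (Bar M) \<in> ?T"
    by (rule memT[OF I_cong_m_barm]) (use M h0 is_subring_closed[OF T] in \<open>auto simp: M_def\<close>)
  \<comment> \<open>Two old indices give an element of \<open>R\<close>, one new index is covered by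
    \<open>w\<close> up to a flip, and two new indices are \<open>Plain M\<close> and
    \<open>Bar M\<close> in some order.\<close>
  have base: "yv (Plain 0) a b \<in> ?T" if ab: "(Plain 0, a, b) \<in> triples M" for a b
  proof -
    have ab': "a \<in> sidxs M" "b \<in> sidxs M" "a \<noteq> Plain 0" "b \<noteq> Plain 0" "a \<noteq> b"
      using ab by (auto simp: triples_def)
    consider "a \<in> sidxs m" "b \<in> sidxs m" | "a \<in> sidxs m" "b = Plain M \<or> b = Bar M"
      | "b \<in> sidxs m" "a = Plain M \<or> a = Bar M" | "a = Plain M" "b = Bar M" | "b = Plain M" "a = Bar M"
      using sM[OF ab'(1)] sM[OF ab'(2)] ab'(5) by blast
    then show ?thesis
    proof cases
      case 1
      then have "yv (Plain 0) a b \<in> R" using ab' by (intro yR) (auto simp: triples_def)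
      then show ?thesis using RT by blast
    next
      case 2
      then show ?thesis using w[of a] ab' by auto
    next
      case 3
      then show ?thesis using w[of b] ab' by (intro flip[OF ab]) auto
    next
      case 4
      then show ?thesis using mM by simp
    next
      case 5
      then show ?thesis using mM by (intro flip[OF ab]) simp
    qed
  qed
  show "yv i j k \<in> ?T" if ijk: "(i, j, k) \<in> triples M"
  proof (cases "Plain 0 \<in> {i, j, k}")
    case True
    then show ?thesis
      using base[of j k] base[of k i] base[of i j] ijk triples_rotate yv_rotate
      by (metis empty_iff insert_iff)
  next
    case False
    have "yv (Plain 0) i j - yv (Plain 0) i k + yv (Plain 0) j k \<in> ?T"
      using ijk False by (intro is_subring_closed[OF T] base) (auto simp: triples_def)
    moreover have "I_cong n (yv i j k) (yv (Plain 0) i j - yv (Plain 0) i k + yv (Plain 0) j k)"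
      using ijk False M by (intro I_cong_cocycle) (auto simp: triples_def sidxs_def)
    ultimately show ?thesis
      using memT by blast
  qed
qed

lemma span_upto_props:
  "m \<le> n \<Longrightarrow> is_subring (span_upto n m) \<and> I_Y n \<subseteq> span_upto n m \<and> (\<forall>i j k. (i, j, k) \<in> triples m \<longrightarrow> yv i j k \<in> span_upto n m)"
proof (induction m)
  case 0
  \<comment> \<open>The indices 0 and -0 alone admit no triple, so stage 0 has no variables to
    contain.\<close>
  have "False" if "(i, j, k) \<in> triples 0" for i j k
    using that by (auto simp: triples_def sidxs_def)
  moreover have "I_Y n \<subseteq> span_upto n 0"
    by (auto intro: exI[of _ 0])
  ultimately show ?case
    using is_subring_span_upto_0 by blast
next
  case (Suc m)
  then have IH: "is_subring (span_upto n m)" "I_Y n \<subseteq> span_upto n m" "\<And>i j k. (i, j, k) \<in> triples m \<Longrightarrow> yv i j k \<in> span_upto n m"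
    by auto
  have "I_Y n \<subseteq> span_upto n (Suc m)"
    using IH(2) by (auto intro: module_span_coeff)
  then show ?case
    using span_upto_step[OF Suc.prems IH] by auto
qed

text \<open>A subring that contains the variables contains every integer polynomial in them.\<close>

lemma carrier_Zy_span_upto: "carrier (Zy n) \<subseteq> span_upto n n"
proof
  fix f assume "f \<in> carrier (Zy n)"
  then show "f \<in> span_upto n n"
    unfolding Zy_def
  proof (induction rule: zpoly_ring_induct)
    note span_upto = span_upto_props[of n n, simplified]
    note cl = is_subring_closed[OF conjunct1[OF span_upto]]
    case (const c)
    have nat: "of_nat k \<in> span_upto n n" for k
      by (induction k) (simp_all add: cl)
    show ?case
      by (cases c) (use nat cl in \<open>simp_all del: of_nat_Suc\<close>)
  next
    case (var x)
    then show ?case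
      using span_upto_props[of n n] by (auto simp: yv_def)
  qed (use span_upto_props[of n n] in \<open>auto intro: is_subring_closed\<close>)
qed

section \<open>Monomials as an integral spanning set\<close>

lemma hset_carrier:
  assumes "1 \<le> m" "m \<le> n" shows "hset m \<subseteq> carrier (Zy n)"
  using assms by (auto simp: hset_def triples_def intro!: yv_carrier)

lemma monoms_0: "monoms 0 = {1}"
  by (auto simp: monoms_def)

text \<open>The factor 1 stands for taking no element of \<open>hset (Suc m)\<close>.\<close>

lemma monoms_Suc: "monoms (Suc m) = {h * b | h b. h \<in> insert 1 (hset (Suc m)) \<and> b \<in> monoms m}"
proof (intro equalityI subsetI)
  fix f assume "f \<in> monoms (Suc m)"
  then obtain M g where f: "f = (\<Prod>m\<in>M. g m)" and M: "M \<subseteq> {1..Suc m}" "\<forall>m\<in>M. g m \<in> hset m"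
    unfolding monoms_def by blast
  let ?M = "M - {Suc m}"
  have b: "(\<Prod>m\<in>?M. g m) \<in> monoms m"
    unfolding monoms_def using M by (intro CollectI exI[of _ ?M] exI[of _ g]) (auto simp: le_Suc_eq)
  have fin: "finite M"
    using M(1) finite_subset by blast
  show "f \<in> {h * b | h b. h \<in> insert 1 (hset (Suc m)) \<and> b \<in> monoms m}"
  proof (cases "Suc m \<in> M")
    case True
    then have "f = g (Suc m) * (\<Prod>m\<in>?M. g m)"
      unfolding f using fin by (rule prod.remove[rotated])
    then show ?thesis
      using b M(2) True by blast
  next
    case False
    then have "f = 1 * (\<Prod>m\<in>?M. g m)"
      by (simp add: f)
    then show ?thesis
      using b by blast
  qed
next
  fix f assume "f \<in> {h * b | h b. h \<in> insert 1 (hset (Suc m)) \<and> b \<in> monoms m}"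
  then obtain h M g where f: "f = h * (\<Prod>m\<in>M. g m)" and h: "h \<in> insert 1 (hset (Suc m))"
    and M: "M \<subseteq> {1..m}" "\<forall>m\<in>M. g m \<in> hset m"
    unfolding monoms_def by blast
  have fin: "finite M" "Suc m \<notin> M"
    using M(1) finite_subset by auto
  show "f \<in> monoms (Suc m)"
  proof (cases "h = 1")
    case True
    then show ?thesis
      unfolding monoms_def f using M by (intro CollectI exI[of _ M] exI[of _ g]) auto
  next
    case False
    have "(\<Prod>l\<in>M. (g(Suc m := h)) l) = (\<Prod>l\<in>M. g l)"
      using fin by (intro prod.cong) auto
    then have "f = (\<Prod>l\<in>insert (Suc m) M. (g(Suc m := h)) l)"
      using fin by (simp add: f)
    then show ?thesis
      unfolding monoms_def using M h False
      by (intro CollectI exI[of _ "insert (Suc m) M"] exI[of _ "g(Suc m := h)"]) auto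
  qed
qed

text \<open>By induction the coefficients from stage \<open>m\<close> are congruent to integer
  combinations of monomials of level \<open>m\<close>; multiplied by 1 or an element of
  \<open>hset (Suc m)\<close>, these become monomials of the next level.\<close>

lemma span_upto_monoms:
  assumes "m \<le> n" "f \<in> span_upto n m"
  shows "\<exists>z\<in>module_span (range of_int) (monoms m). I_cong n f z"
  using assms
proof (induction m arbitrary: f)
  case 0
  then obtain c x where "f = of_int c + x" "x \<in> I_Y n"
    by auto
  then show ?case
    using module_span_coeff[of "of_int c" "range of_int" "monoms 0"]
    by (intro bexI[of _ "of_int c"]) (simp_all add: I_cong_def monoms_0)
next
  case (Suc m)
  have Z: "is_subring (range of_int :: yvar zpoly set)"
    unfolding is_subring_def by (metis (no_types, lifting) of_int_1 of_int_diff of_int_mult imageE rangeI)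
  have shift: "h * z \<in> module_span (range of_int) (monoms (Suc m))"
    if "h \<in> insert 1 (hset (Suc m))" "z \<in> module_span (range of_int) (monoms m)" for h z
    using that(2)
  proof induction
    case (step r b x)
    have "h * b \<in> monoms (Suc m)"
      using that(1) step(2) by (auto simp: monoms_Suc)
    from module_span.step[OF step(1) this step(4)] show ?case
      by (simp add: algebra_simps)
  qed (simp add: module_span.zero)
  have hc: "h \<in> carrier (Zy n)" if "h \<in> insert 1 (hset (Suc m))" for h
    using that hset_carrier[of "Suc m" n] Suc.prems(1) by (auto simp: Zy_closed)
  from Suc.prems(2) have "f \<in> module_span (span_upto n m) (insert 1 (hset (Suc m)))"
    by simp
  then show ?case
  proof induction
    case zero
    then show ?case
      by (intro bexI[of _ 0]) (simp_all add: I_cong_refl module_span.zero)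
  next
    case (step r h x)
    obtain z where z: "z \<in> module_span (range of_int) (monoms m)" "I_cong n r z"
      using Suc.IH[OF _ step(1)] Suc.prems(1) by auto
    obtain y where y: "y \<in> module_span (range of_int) (monoms (Suc m))" "I_cong n x y"
      using step by blast
    have "I_cong n (r * h + x) (h * z + y)"
      using I_cong_add[OF I_cong_scale[OF z(2) hc[OF step(2)]] y(2)] by (simp add: mult.commute)
    then show ?case
      using module_span_add[OF shift[OF step(2) z(1)] y(1)] by blast
  qed
qed

lemma finite_monoms: "finite (monoms n)"
proof (induction n)
  case (Suc n)
  have "monoms (Suc n) = (\<lambda>(h, b). h * b) ` (insert 1 (hset (Suc n)) \<times> monoms n)"
    by (auto simp: monoms_Suc)
  then show ?case
    using Suc by (simp add: hset_def)
qed (simp add: monoms_0)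

lemma module_span_finite_sum:
  assumes "finite B" "z \<in> module_span (range of_int) B"
  shows "\<exists>c. z = (\<Sum>b\<in>B. of_int (c b) * b)"
  using assms(2)
proof induction
  case zero
  show ?case by (intro exI[of _ "\<lambda>_. 0"]) simp
next
  case (step r g x)
  then obtain c a where c: "x = (\<Sum>b\<in>B. of_int (c b) * b)" and a: "r = of_int a"
    by blast
  \<comment> \<open>Repeated occurrences of a generator are collected: its coefficient absorbs the
    new scalar.\<close>
  have "(\<Sum>b\<in>B. of_int ((c(g := c g + a)) b) * b) = (\<Sum>b\<in>B. of_int (c b) * b + (if b = g then of_int a * g else 0))"
    by (intro sum.cong) (auto simp: algebra_simps)
  also have "\<dots> = x + r * g"
    using step(2) assms(1) by (simp add: sum.distrib c a)
  finally have "r * g + x = (\<Sum>b\<in>B. of_int ((c(g := c g + a)) b) * b)"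
    by (simp add: add.commute)
  then show ?case by blast
qed

lemma Zy_monoms:
  assumes "f \<in> carrier (Zy n)"
  shows "\<exists>c. I_cong n f (\<Sum>b\<in>monoms n. of_int (c b) * b)"
  using span_upto_monoms[of n n f] carrier_Zy_span_upto assms module_span_finite_sum[OF finite_monoms] by blast

section \<open>Linear independence of the monomials\<close>

text \<open>The set \<open>{1} \<union> h\<^sub>m\<close> is indexed by the signed indices below \<open>m\<close>, with \<open>Plain 0\<close> for the
  factor \<open>1\<close>: apart from this one, the factor with index \<open>s\<close> jumps upwards when \<open>p\<^sub>m\<close> passes through
  \<open>p\<^sub>s\<close>.\<close>

fun basis_factor :: "nat \<Rightarrow> sidx \<Rightarrow> yvar zpoly" where
  "basis_factor m (Plain i) = (if i = 0 then 1 else yv (Plain 0) (Plain i) (Plain m))"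
| "basis_factor m (Bar i) = (if i = 0 then yv (Plain 0) (Bar 0) (Plain m) else yv (Plain 0) (Plain i) (Bar m))"

text \<open>A list codes a monomial: an entry followed by l further entries selects the factor of
  level l + 1. Independence is first proved for codes, as distinct codes are not yet known to give
  distinct polynomials.\<close>

fun basis_index :: "nat \<Rightarrow> sidx list set" where
  "basis_index 0 = {[]}"
| "basis_index (Suc n) = (\<lambda>(s, \<kappa>). s # \<kappa>) ` (sidxs n \<times> basis_index n)"

fun basis_monom :: "sidx list \<Rightarrow> yvar zpoly" where
  "basis_monom [] = 1"
| "basis_monom (s # \<kappa>) = basis_factor (Suc (length \<kappa>)) s * basis_monom \<kappa>"

lemma length_basis_index: "\<kappa> \<in> basis_index n \<Longrightarrow> length \<kappa> = n"
  by (induction n arbitrary: \<kappa>) auto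

lemma finite_basis_index [simp]: "finite (basis_index n)"
  by (induction n) auto

lemma basis_factor_image: "basis_factor (Suc n) ` sidxs n = insert 1 (hset (Suc n))"
proof -
  have "{..n} = insert 0 {1..<Suc n}"
    by auto
  then have "sidxs n = {Plain 0, Bar 0} \<union> Plain ` {1..<Suc n} \<union> Bar ` {1..<Suc n}"
    by (auto simp: sidxs_def)
  then show ?thesis
    by (auto simp: hset_def image_Un image_image)
qed

lemma basis_monom_image: "basis_monom ` basis_index n = monoms n"
proof (induction n)
  case (Suc n)
  have "basis_monom ` basis_index (Suc n) = (\<lambda>(s, \<kappa>). basis_factor (Suc n) s * basis_monom \<kappa>) ` (sidxs n \<times> basis_index n)"
    unfolding basis_index.simps image_image by (intro image_cong) (auto simp: length_basis_index)
  also have "\<dots> = {h * b | h b. h \<in> basis_factor (Suc n) ` sidxs n \<and> b \<in> basis_monom ` basis_index n}"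
    by force
  finally show ?case
    by (simp only: Suc basis_factor_image monoms_Suc)
qed (simp add: monoms_0)

text \<open>Lower levels do not see the last point, which can therefore move while their values stay
  fixed.\<close>

lemma eval_at_basis_monom_cong:
  assumes "\<And>i. i \<le> n \<Longrightarrow> p i = q i" "\<kappa> \<in> basis_index n"
  shows "eval_at p (basis_monom \<kappa>) = eval_at q (basis_monom \<kappa>)"
  using assms
proof (induction n arbitrary: \<kappa>)
  case (Suc n)
  then obtain s \<mu> where \<kappa>: "\<kappa> = s # \<mu>" "s \<in> sidxs n" "\<mu> \<in> basis_index n"
    by auto
  have "eval_at p (basis_factor (Suc n) s) = eval_at q (basis_factor (Suc n) s)"
    using Suc.prems(1) \<kappa>(2) by (cases s) (simp_all add: eval_at_yv)
  then show ?case
    using Suc \<kappa> by (simp add: length_basis_index)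
qed simp

section \<open>Passing one point through another\<close>

lemma cis_lift:
  assumes "a \<in> U1" "w \<in> U1" "a \<noteq> w"
  obtains \<alpha> \<beta> where "a = cis \<alpha>" "w = cis \<beta>" "\<alpha> < \<beta>" "\<beta> < \<alpha> + 2 * pi"
proof -
  have ne: "Arg2pi a \<noteq> Arg2pi w"
    using assms by (simp add: Arg2pi_U1_eq_iff)
  show thesis
  proof (cases "Arg2pi a < Arg2pi w")
    case True
    then show ?thesis
      using that[of "Arg2pi a" "Arg2pi w"] cis_Arg2pi[OF assms(1)] cis_Arg2pi[OF assms(2)]
        Arg2pi[of a] Arg2pi[of w] by auto
  next
    case False
    have "cis (Arg2pi w + 2 * pi) = w"
      using cis_Arg2pi[OF assms(2)] by (simp flip: cis_mult)
    then show ?thesis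
      using that[of "Arg2pi a" "Arg2pi w + 2 * pi"] cis_Arg2pi[OF assms(1)] False ne
        Arg2pi[of a] Arg2pi[of w] by auto
  qed
qed

text \<open>The two points lie just before and just after \<open>w\<close>. Near \<open>w\<close>
  the orders \<open>ccw a b\<close> with \<open>a\<close> and \<open>b\<close> away from
  \<open>w\<close> are constant, whereas \<open>ccw a0 w\<close> changes from false to true.\<close>

lemma ccw_jump:
  assumes "a0 \<in> U1" "w \<in> U1" "a0 \<noteq> w" "finite A" "finite X"
    and A: "\<And>a b. (a, b) \<in> A \<Longrightarrow> a \<in> U1 \<and> b \<in> U1 \<and> a \<noteq> b \<and> a \<noteq> w \<and> b \<noteq> w"
  shows "\<exists>z1 z2. z1 \<in> U1 - X \<and> z2 \<in> U1 - X \<and> (\<forall>(a, b)\<in>A. ccw a b z1 \<longleftrightarrow> ccw a b z2) \<and>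
    ccw a0 w z2 \<and> \<not> ccw a0 w z1"
proof -
  define f where "f \<epsilon> = w * cis \<epsilon>" for \<epsilon>
  obtain \<alpha> \<beta> where ab: "a0 = cis \<alpha>" "w = cis \<beta>" "\<alpha> < \<beta>" "\<beta> < \<alpha> + 2 * pi"
    using cis_lift[OF assms(1-3)] .
  let ?F = "at_right (0::real)"
  have fU: "f \<epsilon> \<in> U1" for \<epsilon>
    using assms(2) by (simp add: f_def norm_mult)
  have small: "eventually (\<lambda>\<epsilon>. 0 < \<epsilon> \<and> \<epsilon> < e) ?F" if "0 < e" for e
    using eventually_at_right_real[OF that] by eventually_elim simp
  have c2: "eventually (\<lambda>\<epsilon>. ccw a0 w (f \<epsilon>)) ?F"
    using small[of "\<alpha> + 2 * pi - \<beta>"] ab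
    by (auto elim!: eventually_mono simp: f_def cis_mult intro!: ccw_cis_less)
  have c1: "eventually (\<lambda>\<epsilon>. ccw a0 (f (- \<epsilon>)) w) ?F"
    using small[of "\<beta> - \<alpha>"] ab
    by (auto elim!: eventually_mono simp: f_def cis_mult intro!: ccw_cis_less)
  have lim2: "(f \<longlongrightarrow> w) ?F" and lim1: "((\<lambda>\<epsilon>. f (- \<epsilon>)) \<longlongrightarrow> w) ?F"
    unfolding f_def by (auto intro!: tendsto_eq_intros)
  \<comment> \<open>The limit \<open>w\<close> may itself belong to \<open>X\<close>; it is avoided
    separately, because \<open>ccw\<close> forces distinct points.\<close>
  have "eventually (\<lambda>\<epsilon>. \<forall>x\<in>X - {w}. f \<epsilon> \<noteq> x) ?F" "eventually (\<lambda>\<epsilon>. \<forall>x\<in>X - {w}. f (- \<epsilon>) \<noteq> x) ?F"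
    using assms(5) lim1 lim2 by (auto intro!: eventually_ball_finite tendsto_imp_eventually_ne)
  moreover have "eventually (\<lambda>\<epsilon>. \<forall>x\<in>A. ccw (fst x) (snd x) (f \<epsilon>) \<longleftrightarrow> ccw (fst x) (snd x) w) ?F"
      "eventually (\<lambda>\<epsilon>. \<forall>x\<in>A. ccw (fst x) (snd x) (f (- \<epsilon>)) \<longleftrightarrow> ccw (fst x) (snd x) w) ?F"
    using assms(4) A assms(2)
    by (intro eventually_ball_finite ballI eventually_ccw_iff lim1 lim2; force simp: fU[simplified])+
  ultimately have "eventually (\<lambda>\<epsilon>. f \<epsilon> \<in> U1 - X \<and> f (- \<epsilon>) \<in> U1 - X \<and>
      (\<forall>(a, b)\<in>A. ccw a b (f (- \<epsilon>)) \<longleftrightarrow> ccw a b (f \<epsilon>)) \<and> ccw a0 w (f \<epsilon>) \<and> \<not> ccw a0 w (f (- \<epsilon>))) ?F"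
    using c1 c2
  proof eventually_elim
    case (elim \<epsilon>)
    have "f \<epsilon> \<noteq> w" "f (- \<epsilon>) \<noteq> w"
      using ccw_distinct[OF elim(5)] ccw_distinct[OF elim(6)] by auto
    moreover have "\<not> ccw a0 w (f (- \<epsilon>))"
      using elim(5) ccw_asym by blast
    moreover have "\<forall>(a, b)\<in>A. ccw a b (f (- \<epsilon>)) \<longleftrightarrow> ccw a b (f \<epsilon>)"
      using elim(3,4) by force
    ultimately show ?case
      using elim(1,2,6) fU by blast
  qed
  then obtain \<epsilon> where "f \<epsilon> \<in> U1 - X \<and> f (- \<epsilon>) \<in> U1 - X \<and>
      (\<forall>(a, b)\<in>A. ccw a b (f (- \<epsilon>)) \<longleftrightarrow> ccw a b (f \<epsilon>)) \<and> ccw a0 w (f \<epsilon>) \<and> \<not> ccw a0 w (f (- \<epsilon>))"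
    using eventually_happens by force
  then show ?thesis
    by blast
qed

lemma conf_extend:
  assumes "q \<in> conf n" "z \<in> U1" "z \<notin> spt q ` sidxs n"
  shows "q(Suc n := z) \<in> conf (Suc n)"
proof -
  have z: "z \<noteq> q i" "z \<noteq> - q i" "q i \<noteq> - z" if "i \<le> n" for i
  proof -
    have "spt q (Plain i) \<in> spt q ` sidxs n" "spt q (Bar i) \<in> spt q ` sidxs n"
      by (rule imageI, simp add: that)+
    then show "z \<noteq> q i" and *: "z \<noteq> - q i"
      using assms(3) by force+
    from * show "q i \<noteq> - z"
      by (metis add.inverse_inverse)
  qed
  have "q(Suc n := z) \<in> {..Suc n} \<rightarrow>\<^sub>E U1"
    using assms(1,2) by (auto simp: conf_def PiE_iff extensional_def)
  then show ?thesis
    using assms(1) z unfolding conf_def by (auto simp: le_Suc_eq dest: z)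
qed

text \<open>Coefficients are isolated by passing \<open>z\<close> through the points one at a time:
  first those other than \<open>q 0\<close> and \<open>- q 0\<close>, then \<open>- q 0\<close>. Any
  admissible \<open>z\<close> finally gives the coefficient of the factor 1.\<close>

lemma basis_factor_indep:
  assumes q: "q \<in> conf n"
    and zero: "\<And>z. z \<in> U1 - spt q ` sidxs n \<Longrightarrow> (\<Sum>s\<in>sidxs n. F s * eval_at (q(Suc n := z)) (basis_factor (Suc n) s)) = 0"
    and "s \<in> sidxs n"
  shows "F s = 0"
proof -
  \<comment> \<open>With \<open>z\<close> last, every factor except 1 is
    \<open>ccw (al s) (spt q s) z\<close>, the indicator of an arc: it jumps up at
    \<open>spt q s\<close> and down at \<open>al s\<close>. For \<open>Bar i\<close> with
    \<open>i\<close> positive, a half turn moves the sign away from \<open>z\<close>, and the arc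
    ends at \<open>- q 0\<close>.\<close>
  define al where "al s = (case s of Plain i \<Rightarrow> q 0 | Bar i \<Rightarrow> if i = 0 then q 0 else - q 0)" for s
  have eval_at: "eval_at (q(Suc n := z)) (basis_factor (Suc n) s) = of_bool (ccw (al s) (spt q s) z)"
    if "s \<in> sidxs n - {Plain 0}" for s z
    using that ccw_uminus[of "q 0" "spt q (bar s)" "-z"] by (cases s) (auto simp: eval_at_yv al_def)
  have al: "al s \<in> U1" "al s \<noteq> spt q s" if "s \<in> sidxs n - {Plain 0}" for s
    using that spt_in_U1[OF q, of "Plain 0"] spt_inj[OF q, of "Plain 0" s] spt_inj[OF q, of "Bar 0" s]
    by (cases s; auto simp: al_def)+
  \<comment> \<open>Subtracting the values before the passage from those after it cancels the
    factors in \<open>S\<close>, which are constant near \<open>spt q t\<close>. Factors whose arc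
    ends at \<open>spt q t\<close> jump as well; \<open>other\<close> asks that their coefficients
    already vanish.\<close>
  have jump: "F t = 0" if t: "t \<in> sidxs n - {Plain 0}"
    and other: "\<And>s. s \<in> sidxs n - {Plain 0, t} \<Longrightarrow> al s = spt q t \<Longrightarrow> F s = 0" for t
  proof -
    define S where "S = {s \<in> sidxs n - {Plain 0, t}. al s \<noteq> spt q t}"
    have "\<exists>z1 z2. z1 \<in> U1 - spt q ` sidxs n \<and> z2 \<in> U1 - spt q ` sidxs n \<and>
        (\<forall>(a, b)\<in>(\<lambda>s. (al s, spt q s)) ` S. ccw a b z1 \<longleftrightarrow> ccw a b z2) \<and>
        ccw (al t) (spt q t) z2 \<and> \<not> ccw (al t) (spt q t) z1"
    proof (rule ccw_jump)
      fix a b assume "(a, b) \<in> (\<lambda>s. (al s, spt q s)) ` S"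
      then obtain s where s: "s \<in> S" "a = al s" "b = spt q s" by blast
      then show "a \<in> U1 \<and> b \<in> U1 \<and> a \<noteq> b \<and> a \<noteq> spt q t \<and> b \<noteq> spt q t"
        using al[of s] spt_in_U1[OF q, of s] spt_inj[OF q, of s t] t by (auto simp: S_def)
    qed (use al t spt_in_U1[OF q] in \<open>auto simp: S_def\<close>)
    then obtain z1 z2 where z: "z1 \<in> U1 - spt q ` sidxs n" "z2 \<in> U1 - spt q ` sidxs n"
        "\<And>s. s \<in> S \<Longrightarrow> ccw (al s) (spt q s) z1 \<longleftrightarrow> ccw (al s) (spt q s) z2"
        "ccw (al t) (spt q t) z2" "\<not> ccw (al t) (spt q t) z1"
      by auto
    have "0 = (\<Sum>s\<in>sidxs n. F s * eval_at (q(Suc n := z2)) (basis_factor (Suc n) s)) -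
        (\<Sum>s\<in>sidxs n. F s * eval_at (q(Suc n := z1)) (basis_factor (Suc n) s))"
      using zero z(1,2) by simp
    also have "\<dots> = (\<Sum>s\<in>sidxs n. if s = t then F t else 0)"
      unfolding sum_subtractf[symmetric]
    proof (rule sum.cong)
      fix s assume s: "s \<in> sidxs n"
      consider "s = Plain 0" | "s = t" | "s \<in> S" | "s \<in> sidxs n - {Plain 0, t}" "al s = spt q t"
        using s by (auto simp: S_def)
      then show "F s * eval_at (q(Suc n := z2)) (basis_factor (Suc n) s) - F s * eval_at (q(Suc n := z1)) (basis_factor (Suc n) s)
          = (if s = t then F t else 0)"
      proof cases
        case 1
        then show ?thesis using t by auto
      next
        case 2
        then show ?thesis using t z(4,5) by (simp add: eval_at del: basis_factor.simps)
      next
        case 3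
        then show ?thesis using z(3)[OF 3] by (simp add: eval_at S_def del: basis_factor.simps)
      next
        case 4
        then show ?thesis using other[OF 4] by simp
      qed
    qed simp
    also have "\<dots> = F t"
      using t by simp
    finally show ?thesis by simp
  qed
  have q0: "spt q (Plain 0) = q 0" "spt q (Bar 0) = - q 0"
    by simp_all
  \<comment> \<open>All arcs end at \<open>q 0\<close> or \<open>- q 0\<close>, so no arc ends at
    \<open>spt q t\<close>.\<close>
  have F1: "F t = 0" if t: "t \<in> sidxs n - {Plain 0, Bar 0}" for t
  proof (rule jump)
    fix s assume "s \<in> sidxs n - {Plain 0, t}" "al s = spt q t"
    moreover have "al s \<in> {spt q (Plain 0), spt q (Bar 0)}"
      by (cases s) (simp_all add: al_def)
    ultimately show "F s = 0"
      using t spt_inj[OF q, of "Plain 0" t] spt_inj[OF q, of "Bar 0" t] by auto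
  qed (use t in auto)
  \<comment> \<open>Other arcs do end at \<open>- q 0\<close>, but \<open>F1\<close> has disposed of
    their coefficients.\<close>
  have F2: "F (Bar 0) = 0"
  proof (rule jump)
    fix s assume "s \<in> sidxs n - {Plain 0, Bar 0}"
    then show "F s = 0" by (rule F1)
  qed simp
  have F3: "F s = 0" if "s \<in> sidxs n - {Plain 0}" for s
    using that F1[of s] F2 by (cases "s = Bar 0") auto
  \<comment> \<open>Only the existence of a point off the finite set is wanted here, hence the empty
    set of constraints.\<close>
  have "\<exists>z1 z2. z1 \<in> U1 - spt q ` sidxs n \<and> z2 \<in> U1 - spt q ` sidxs n \<and>
        (\<forall>(a, b)\<in>{}. ccw a b z1 \<longleftrightarrow> ccw a b z2) \<and> ccw (q 0) (- q 0) z2 \<and> \<not> ccw (q 0) (- q 0) z1"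
    using spt_in_U1[OF q, of "Plain 0"] spt_inj[OF q, of "Plain 0" "Bar 0"]
    by (intro ccw_jump) auto
  then obtain z where "z \<in> U1 - spt q ` sidxs n" by blast
  from zero[OF this] have "0 = (\<Sum>s\<in>sidxs n. F s * eval_at (q(Suc n := z)) (basis_factor (Suc n) s))" by simp
  also have "\<dots> = (\<Sum>s\<in>sidxs n. if s = Plain 0 then F s else 0)"
    using F3 by (intro sum.cong) auto
  also have "\<dots> = F (Plain 0)"
    by simp
  finally show ?thesis
    using F3 assms(3) by (cases "s = Plain 0") auto
qed

text \<open>Once the factor of the last level is split off, its coefficient is a combination of
  lower monomials evaluated at \<open>q\<close>. By \<open>basis_factor_indep\<close> this
  combination vanishes for every \<open>q\<close>, and the induction hypothesis applies.\<close>

lemma basis_monom_indep: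
  assumes "\<And>p. p \<in> conf n \<Longrightarrow> (\<Sum>\<kappa>\<in>basis_index n. d \<kappa> * eval_at p (basis_monom \<kappa>)) = 0" "\<kappa> \<in> basis_index n"
  shows "d \<kappa> = (0::int)"
  using assms
proof (induction n arbitrary: d \<kappa>)
  case 0
  have "(\<lambda>i\<in>{..0}. 1) \<in> conf 0"
    by (auto simp: conf_def)
  then show ?case
    using 0 by force
next
  case (Suc n)
  have inj: "inj_on (\<lambda>(s, \<kappa>). s # \<kappa>) (sidxs n \<times> basis_index n)"
    by (auto simp: inj_on_def)
  obtain s \<mu> where \<kappa>: "\<kappa> = s # \<mu>" "s \<in> sidxs n" "\<mu> \<in> basis_index n"
    using Suc.prems(2) by auto
  have "d (s # \<mu>) = 0"
  proof (rule Suc.IH[of "\<lambda>\<mu>. d (s # \<mu>)"])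
    fix q assume q: "q \<in> conf n"
    define F where "F s = (\<Sum>\<mu>\<in>basis_index n. d (s # \<mu>) * eval_at q (basis_monom \<mu>))" for s
    have "F s = 0"
    proof (rule basis_factor_indep[OF q _ \<kappa>(2)])
      fix z assume z: "z \<in> U1 - spt q ` sidxs n"
      let ?p = "q(Suc n := z)"
      have p: "?p \<in> conf (Suc n)"
        using conf_extend[OF q] z by blast
      have "0 = (\<Sum>\<kappa>\<in>basis_index (Suc n). d \<kappa> * eval_at ?p (basis_monom \<kappa>))"
        by (rule Suc.prems(1)[OF p, symmetric])
      also have "\<dots> = (\<Sum>(s, \<mu>)\<in>sidxs n \<times> basis_index n. d (s # \<mu>) * eval_at ?p (basis_monom (s # \<mu>)))"
        unfolding basis_index.simps sum.reindex[OF inj] by (simp add: case_prod_beta)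
      also have "\<dots> = (\<Sum>s\<in>sidxs n. \<Sum>\<mu>\<in>basis_index n. d (s # \<mu>) * eval_at ?p (basis_monom (s # \<mu>)))"
        by (simp add: sum.cartesian_product)
      also have "\<dots> = (\<Sum>s\<in>sidxs n. F s * eval_at ?p (basis_factor (Suc n) s))"
        unfolding F_def sum_distrib_right
      proof (intro sum.cong refl)
        fix s \<mu> assume "s \<in> sidxs n" "\<mu> \<in> basis_index n"
        moreover have "eval_at ?p (basis_monom \<mu>) = eval_at q (basis_monom \<mu>)"
          by (rule eval_at_basis_monom_cong[OF _ \<open>\<mu> \<in> basis_index n\<close>]) simp
        ultimately show "d (s # \<mu>) * eval_at ?p (basis_monom (s # \<mu>)) = d (s # \<mu>) * eval_at q (basis_monom \<mu>) * eval_at ?p (basis_factor (Suc n) s)"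
          by (simp add: length_basis_index del: basis_factor.simps)
      qed
      finally show "(\<Sum>s\<in>sidxs n. F s * eval_at ?p (basis_factor (Suc n) s)) = 0" by simp
    qed
    then show "(\<Sum>\<mu>\<in>basis_index n. d (s # \<mu>) * eval_at q (basis_monom \<mu>)) = 0"
      by (simp add: F_def)
  qed (fact \<kappa>(3))
  then show ?case
    by (simp add: \<kappa>(1))
qed

section \<open>Connectedness of the chambers\<close>

lemma topspace_conf_space: "topspace (conf_space n) = conf n"
  by (auto simp: conf_space_def conf_def)

lemma continuous_map_spt:
  assumes "s \<in> sidxs n"
  shows "continuous_map (conf_space n) euclidean (\<lambda>p. spt p s)"
proof -
  have *: "continuous_map (conf_space n) euclidean (\<lambda>p. p i)" if "i \<le> n" for i
    using continuous_map_product_projection[of i "{..n}" "\<lambda>_. top_of_set U1"] that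
    unfolding conf_space_def
    by (intro continuous_map_from_subtopology) (auto simp: continuous_map_in_subtopology)
  show ?thesis
  proof (cases s)
    case (Bar i)
    have "continuous_map (conf_space n) euclidean (uminus \<circ> (\<lambda>p. p i))"
      using assms Bar by (intro continuous_map_compose[OF *]) (auto intro: continuous_intros)
    then show ?thesis
      by (simp add: Bar comp_def)
  qed (use assms * in simp)
qed

lemma openin_ccw:
  assumes "i \<in> sidxs n" "j \<in> sidxs n" "k \<in> sidxs n"
  shows "openin (conf_space n) {p \<in> conf n. ccw (spt p i) (spt p j) (spt p k)}"
proof -
  have Re: "continuous_map (conf_space n) euclideanreal (\<lambda>p. Re (spt p s))"
    and Im: "continuous_map (conf_space n) euclideanreal (\<lambda>p. Im (spt p s))" if "s \<in> sidxs n" for s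
    using continuous_map_compose[OF continuous_map_spt[OF that], of euclideanreal Re]
      continuous_map_compose[OF continuous_map_spt[OF that], of euclideanreal Im]
      continuous_on_Re[OF continuous_on_id, of UNIV] continuous_on_Im[OF continuous_on_id, of UNIV]
    by (simp_all add: comp_def)
  \<comment> \<open>Written as a real polynomial in the coordinates, the area is visibly continuous
    on the configuration space.\<close>
  have "orient a b c = (Re b - Re a) * (Im c - Im a) - (Im b - Im a) * (Re c - Re a)" for a b c
    by (simp add: orient_def algebra_simps)
  then have "continuous_map (conf_space n) euclideanreal (\<lambda>p. orient (spt p i) (spt p j) (spt p k))"
    using assms by (simp add: Re Im continuous_map_real_mult continuous_map_diff)
  from openin_continuous_map_preimage[OF this, of "{0<..}"]
  have "openin (conf_space n) {p \<in> conf n. 0 < orient (spt p i) (spt p j) (spt p k)}"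
    by (simp add: topspace_conf_space)
  also have "{p \<in> conf n. 0 < orient (spt p i) (spt p j) (spt p k)} =
      {p \<in> conf n. ccw (spt p i) (spt p j) (spt p k)}"
    using assms spt_in_U1 by (intro Collect_cong conj_cong refl ccw_iff_orient[symmetric])
  finally show ?thesis .
qed

lemma ccw_spt_flip:
  assumes "p \<in> conf n" "(i, j, k) \<in> triples n"
  shows "ccw (spt p i) (spt p k) (spt p j) \<longleftrightarrow> \<not> ccw (spt p i) (spt p j) (spt p k)"
  using assms spt_in_U1[OF assms(1)] spt_inj[OF assms(1)]
  by (intro ccw_total) (simp_all add: triples_def)

text \<open>The negation of a cyclic order is the opposite cyclic order, hence open too.\<close>

lemma openin_ccw_iff:
  assumes "(i, j, k) \<in> triples n"
  shows "openin (conf_space n) {p \<in> conf n. ccw (spt p i) (spt p j) (spt p k) \<longleftrightarrow> b}"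
proof (cases b)
  case False
  have "{p \<in> conf n. ccw (spt p i) (spt p j) (spt p k) \<longleftrightarrow> b} =
      {p \<in> conf n. ccw (spt p i) (spt p k) (spt p j)}"
    using ccw_spt_flip[OF _ assms] False by auto
  then show ?thesis
    using openin_ccw[of i n k j] assms by (simp add: triples_def)
qed (use openin_ccw[of i n j k] assms in \<open>simp add: triples_def\<close>)

lemma heaviside_orbit':
  assumes "p \<in> conf n" "(i, j, k) \<in> triples n"
  shows "heaviside n i j k (orbit n p) = of_bool (ccw (spt p i) (spt p j) (spt p k))"
  using heaviside_orbit[of p n i j k] assms by (simp add: triples_def)

text \<open>The preimage in the configuration space is cut out by finitely many open conditions,
  which is what openness in the quotient means.\<close>

lemma openin_heaviside_level:
  assumes "P \<in> topspace (Y_space n)"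
  shows "openin (Y_space n) {Q \<in> topspace (Y_space n).
    \<forall>(i, j, k)\<in>triples n. heaviside n i j k Q = heaviside n i j k P}" (is "openin _ ?U")
proof -
  obtain p where p: "p \<in> conf n" "P = orbit n p"
    using assms by (auto simp: topspace_Y_space)
  define U where "U = ?U"
  define B where "B = (\<lambda>(i, j, k). {q \<in> conf n. ccw (spt q i) (spt q j) (spt q k) \<longleftrightarrow>
    ccw (spt p i) (spt p j) (spt p k)})"
  have "openin (conf_space n) ((\<Inter>x\<in>triples n. B x) \<inter> topspace (conf_space n))"
    by (rule openin_INT[OF finite_triples]) (auto simp: B_def intro: openin_ccw_iff)
  moreover have "orbit n q \<in> U \<longleftrightarrow> (\<forall>x\<in>triples n. q \<in> B x)" if "q \<in> conf n" for q
    using that p heaviside_orbit'[OF that] heaviside_orbit'[OF p(1)]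
    by (auto simp: U_def B_def topspace_Y_space)
  then have "(\<Inter>x\<in>triples n. B x) \<inter> topspace (conf_space n) = {q \<in> topspace (conf_space n). orbit n q \<in> U}"
    unfolding topspace_conf_space by blast
  ultimately have "openin (conf_space n) {q \<in> topspace (conf_space n). orbit n q \<in> U}"
    by simp
  moreover have "U \<subseteq> orbit n ` topspace (conf_space n)"
    by (auto simp: U_def topspace_conf_space topspace_Y_space)
  ultimately have "openin (Y_space n) U"
    unfolding Y_space_def openin_quotient_topology by blast
  then show ?thesis
    by (simp add: U_def)
qed

section \<open>Normalised configurations and paths between them\<close>

lemma conf_normalize:
  assumes "p \<in> conf n"
  obtains q where "q \<in> conf n" "q 0 = 1" "orbit n q = orbit n p"
proof -
  define u where "u = inverse (p 0)"
  define q where "q = (\<lambda>i\<in>{..n}. u * p i)"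
  have p0: "norm (p 0) = 1" "p 0 \<noteq> 0"
    using spt_in_U1[OF assms, of "Plain 0"] by auto
  have u: "norm u = 1" "u \<noteq> 0" "u * p 0 = 1"
    using p0 by (auto simp: u_def norm_inverse)
  have "q i \<in> U1" if "i \<le> n" for i
    using spt_in_U1[OF assms, of "Plain i"] that u by (simp add: q_def norm_mult)
  moreover have "q i \<noteq> q j \<and> q i \<noteq> - q j" if "i \<le> n" "j \<le> n" "i \<noteq> j" for i j
  proof -
    have "p i \<noteq> p j" "p i \<noteq> - p j"
      using assms that by (auto simp: conf_def)
    then have "u * p i \<noteq> u * p j" "u * p i \<noteq> u * (- p j)"
      using u(2) by (simp_all only: mult_cancel_left) simp_all
    then show ?thesis
      using that by (simp add: q_def)
  qed
  ultimately have "q \<in> conf n"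
    by (auto simp: conf_def q_def)
  moreover have "q 0 = 1"
    using u by (simp add: q_def)
  moreover have "orbit n q = orbit n p"
  proof (intro equalityI subsetI)
    fix x assume "x \<in> orbit n q"
    then obtain v where "v \<in> U1" "x = (\<lambda>i\<in>{..n}. v * q i)"
      by (auto simp: orbit_def)
    then have "v * u \<in> U1" "x = (\<lambda>i\<in>{..n}. (v * u) * p i)"
      using u by (auto simp: q_def norm_mult)
    then show "x \<in> orbit n p"
      unfolding orbit_def by blast
  next
    fix x assume "x \<in> orbit n p"
    then obtain v where "v \<in> U1" "x = (\<lambda>i\<in>{..n}. v * p i)"
      by (auto simp: orbit_def)
    moreover have "p i = p 0 * (u * p i)" for i
      using u by (metis mult.assoc mult.commute mult_1)
    ultimately have "v * p 0 \<in> U1" "x = (\<lambda>i\<in>{..n}. (v * p 0) * q i)"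
      using p0 by (auto simp: q_def norm_mult mult.assoc cong: restrict_cong)
    then show "x \<in> orbit n q"
      unfolding orbit_def by blast
  qed
  ultimately show thesis
    by (rule that)
qed

definition same_pattern :: "nat \<Rightarrow> (nat \<Rightarrow> complex) \<Rightarrow> (nat \<Rightarrow> complex) \<Rightarrow> bool" where
  "same_pattern n p q \<longleftrightarrow> (\<forall>(i, j, k)\<in>triples n.
     ccw (spt p i) (spt p j) (spt p k) \<longleftrightarrow> ccw (spt q i) (spt q j) (spt q k))"

lemma Arg2pi_1 [simp]: "Arg2pi 1 = 0" and Arg2pi_minus_1 [simp]: "Arg2pi (- 1) = pi"
  using Arg2pi_of_real[of 1] Arg2pi_of_real[of "- 1"] by simp_all

lemma Arg2pi_conf:
  assumes "p \<in> conf n" "p 0 = 1" "i \<le> n" "i \<noteq> 0"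
  shows "0 < Arg2pi (p i)" "Arg2pi (p i) \<noteq> pi"
proof -
  have "p i \<noteq> 1" "p i \<noteq> - 1" "p i \<in> U1"
    using spt_inj[OF assms(1), of "Plain i" "Plain 0"] spt_inj[OF assms(1), of "Plain i" "Bar 0"]
      spt_in_U1[OF assms(1), of "Plain i"] assms by auto
  then have "Arg2pi (p i) \<noteq> Arg2pi 1" "Arg2pi (p i) \<noteq> Arg2pi (- 1)"
    by (subst Arg2pi_U1_eq_iff; simp)+
  then show "0 < Arg2pi (p i)" "Arg2pi (p i) \<noteq> pi"
    using Arg2pi[of "p i"] by auto
qed

text \<open>Seen from \<open>p 0 = 1\<close>, cyclic order is the order of the angles; index 0 is
  separated because it has angle 0 and occurs in no triple with the base point.\<close>

lemma Arg2pi_less_iff: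
  assumes "p \<in> conf n" "p 0 = 1" "i \<le> n" "j \<le> n" "i \<noteq> j"
  shows "Arg2pi (p i) < Arg2pi (p j) \<longleftrightarrow>
    i = 0 \<or> j \<noteq> 0 \<and> ccw (spt p (Plain 0)) (spt p (Plain i)) (spt p (Plain j))"
  using assms Arg2pi_conf[OF assms(1,2,3)] Arg2pi_conf[OF assms(1,2,4)] Arg2pi[of "p i"]
    ccw_1_iff[of "p i" "p j"] spt_in_U1[OF assms(1), of "Plain i"] spt_in_U1[OF assms(1), of "Plain j"]
  by (cases "i = 0"; cases "j = 0") auto

text \<open>Within [0, 2 pi) such a gap means that \<open>p j\<close> lies in the upper half circle,
  so that passing to \<open>- p j\<close> adds \<open>pi\<close> to the angle, and that
  \<open>p i\<close> comes after \<open>- p j\<close>. The pattern of cyclic orders thus determines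
  the gap condition.\<close>

lemma Arg2pi_diff_gt_pi_iff:
  assumes "p \<in> conf n" "p 0 = 1" "i \<le> n" "j \<le> n" "i \<noteq> j"
  shows "Arg2pi (p i) - Arg2pi (p j) > pi \<longleftrightarrow> i \<noteq> 0 \<and>
    (if j = 0 then ccw (spt p (Plain 0)) (spt p (Bar 0)) (spt p (Plain i))
     else ccw (spt p (Plain 0)) (spt p (Plain j)) (spt p (Bar 0)) \<and>
       ccw (spt p (Plain 0)) (spt p (Bar j)) (spt p (Plain i)))"
proof -
  have U: "p i \<in> U1" "p j \<in> U1"
    using spt_in_U1[OF assms(1), of "Plain i"] spt_in_U1[OF assms(1), of "Plain j"] assms by auto
  then have "p j \<noteq> 0"
    by auto
  note minus = Arg2pi_minus[OF this]
  have b: "0 \<le> Arg2pi (p j)" "Arg2pi (p i) < 2 * pi"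
    using Arg2pi by auto
  show ?thesis
  proof (cases "i = 0")
    case True
    then show ?thesis
      using assms(2) order_trans[of "- Arg2pi (p j)" 0 pi] b(1) by (simp add: not_less)
  next
    case i: False
    show ?thesis
    proof (cases "j = 0")
      case True
      then show ?thesis
        using i assms(2) U by (simp add: ccw_1_iff)
    next
      case False
      have pj: "0 < Arg2pi (p j)"
        using Arg2pi_conf(1)[OF assms(1,2,4) False] .
      have "ccw 1 (p j) (- 1) \<longleftrightarrow> Arg2pi (p j) < pi"
        using U pj by (simp add: ccw_1_iff)
      moreover have "ccw 1 (- p j) (p i) \<longleftrightarrow> 0 < Arg2pi (- p j) \<and> Arg2pi (- p j) < Arg2pi (p i)"
        using U by (simp add: ccw_1_iff)
      ultimately show ?thesis
        using i False assms(2) minus pj b by auto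
    qed
  qed
qed

lemma sin_neq_0_if:
  assumes "\<bar>x\<bar> < 2 * pi" "x \<noteq> 0" "\<bar>x\<bar> \<noteq> pi"
  shows "sin x \<noteq> 0"
proof -
  have *: "sin y \<noteq> 0" if "0 < y" "y < 2 * pi" "y \<noteq> pi" for y
    using that sin_gt_zero[of y] sin_lt_zero[of y] by (cases "y < pi") auto
  then show ?thesis
    using *[of x] *[of "- x"] assms by (cases "0 < x") auto
qed

text \<open>The pattern decides in which of the intervals (-2 pi, -pi), (-pi, 0), (0, pi), (pi, 2
  pi) an angle difference lies. Intervals are convex, so an interpolated difference stays inside and
  is never a multiple of \<open>pi\<close>.\<close>

lemma chamber_path_in_conf:
  assumes p: "p \<in> conf n" "p 0 = 1" and q: "q \<in> conf n" "q 0 = 1" and pat: "same_pattern n p q"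
    and t: "0 \<le> t" "t \<le> (1::real)"
  shows "(\<lambda>i\<in>{..n}. cis ((1 - t) * Arg2pi (p i) + t * Arg2pi (q i))) \<in> conf n"
proof -
  define x where "x i = (1 - t) * Arg2pi (p i) + t * Arg2pi (q i)" for i
  have pat': "ccw (spt p i) (spt p j) (spt p k) \<longleftrightarrow> ccw (spt q i) (spt q j) (spt q k)"
    if "(i, j, k) \<in> triples n" for i j k
    using pat that by (auto simp: same_pattern_def)
  have less: "Arg2pi (p i) < Arg2pi (p j) \<longleftrightarrow> Arg2pi (q i) < Arg2pi (q j)"
    and gt: "Arg2pi (p i) - Arg2pi (p j) > pi \<longleftrightarrow> Arg2pi (q i) - Arg2pi (q j) > pi"
    if "i \<le> n" "j \<le> n" "i \<noteq> j" for i j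
    unfolding Arg2pi_less_iff[OF p that] Arg2pi_less_iff[OF q that]
      Arg2pi_diff_gt_pi_iff[OF p that] Arg2pi_diff_gt_pi_iff[OF q that]
    using that pat'[of "Plain 0" "Plain i" "Plain j"] pat'[of "Plain 0" "Bar 0" "Plain i"]
      pat'[of "Plain 0" "Plain j" "Bar 0"] pat'[of "Plain 0" "Bar j" "Plain i"]
    by (auto simp: triples_def)
  have ne: "\<bar>Arg2pi (r i) - Arg2pi (r j)\<bar> < 2 * pi \<and> Arg2pi (r i) \<noteq> Arg2pi (r j) \<and>
      \<bar>Arg2pi (r i) - Arg2pi (r j)\<bar> \<noteq> pi" if r: "r \<in> conf n" and ij: "i \<le> n" "j \<le> n" "i \<noteq> j" for r i j
  proof -
    have U: "r i \<in> U1" "r j \<in> U1"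
      using spt_in_U1[OF r, of "Plain i"] spt_in_U1[OF r, of "Plain j"] ij by auto
    have rr: "r i \<noteq> r j" "r i \<noteq> - r j"
      using r ij by (auto simp: conf_def)
    have "r j \<noteq> 0" using U by auto
    from Arg2pi_minus[OF this] have "\<bar>Arg2pi (r i) - Arg2pi (r j)\<bar> \<noteq> pi"
      using rr(2) U Arg2pi_U1_eq_iff[of "r i" "- r j"] Arg2pi[of "r i"] Arg2pi[of "r j"]
      by (auto split: if_splits)
    moreover have "Arg2pi (r i) \<noteq> Arg2pi (r j)"
      using rr(1) U by (simp add: Arg2pi_U1_eq_iff)
    ultimately show ?thesis
      using Arg2pi[of "r i"] Arg2pi[of "r j"] by auto
  qed
  have sin: "sin (x i - x j) \<noteq> 0" if ij: "i \<le> n" "j \<le> n" "i \<noteq> j" for i j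
  proof -
    let ?D = "Arg2pi (p i) - Arg2pi (p j)" and ?E = "Arg2pi (q i) - Arg2pi (q j)"
    have eq: "x i - x j = (1 - t) *\<^sub>R ?D + t *\<^sub>R ?E"
      by (simp add: x_def algebra_simps)
    have conv: "x i - x j \<in> {l<..<u}" if "?D \<in> {l<..<u}" "?E \<in> {l<..<u}" for l u
      unfolding eq by (rule convexD_alt[OF convex_real_interval(8) that t])
    have D: "\<bar>?D\<bar> < 2 * pi" "?D \<noteq> 0" "\<bar>?D\<bar> \<noteq> pi" and E: "\<bar>?E\<bar> < 2 * pi" "?E \<noteq> 0" "\<bar>?E\<bar> \<noteq> pi"
      using ne[OF p(1) ij] ne[OF q(1) ij] by auto
    have cmp: "?D < 0 \<longleftrightarrow> ?E < 0" "?D > pi \<longleftrightarrow> ?E > pi" "?D < - pi \<longleftrightarrow> ?E < - pi"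
      using less[OF ij] gt[OF ij] gt[OF ij(2,1)] ij(3) by auto
    consider "?D > pi" | "0 < ?D" "?D < pi" | "- pi < ?D" "?D < 0" | "?D < - pi"
      using D by linarith
    then have "\<bar>x i - x j\<bar> < 2 * pi \<and> x i - x j \<noteq> 0 \<and> \<bar>x i - x j\<bar> \<noteq> pi"
    proof cases
      case 1
      then have "x i - x j \<in> {pi<..<2 * pi}"
        using cmp D E by (intro conv) auto
      then show ?thesis using pi_gt_zero by simp
    next
      case 2
      then have "x i - x j \<in> {0<..<pi}"
        using cmp D E by (intro conv) auto
      then show ?thesis using pi_gt_zero by simp
    next
      case 3
      then have "x i - x j \<in> {-pi<..<0}"
        using cmp D E by (intro conv) auto
      then show ?thesis using pi_gt_zero by simp
    next
      case 4
      then have "x i - x j \<in> {-(2 * pi)<..<-pi}"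
        using cmp D E by (intro conv) auto
      then show ?thesis using pi_gt_zero by simp
    qed
    then show ?thesis
      using sin_neq_0_if by blast
  qed
  \<comment> \<open>A nonzero sine of the difference excludes both coincident and antipodal
    points.\<close>
  have "cis (x i) \<noteq> cis (x j) \<and> cis (x i) \<noteq> - cis (x j)" if ij: "i \<le> n" "j \<le> n" "i \<noteq> j" for i j
    using sin[OF ij] by (auto simp: complex_eq_iff sin_diff)
  then show ?thesis
    by (auto simp: conf_def x_def)
qed

text \<open>Both orbits have representatives with first entry 1, and these inherit the common
  pattern because Heaviside functions depend on the orbit only. Interpolating the angles joins them
  by a path of configurations.\<close>

lemma locally_constant_same_pattern:
  assumes f: "locally_constant (Y_space n) f" and "p \<in> conf n" "q \<in> conf n" "same_pattern n p q"
  shows "f (orbit n p) = f (orbit n q)"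
proof -
  obtain p' where p': "p' \<in> conf n" "p' 0 = 1" "orbit n p' = orbit n p"
    using conf_normalize[OF assms(2)] .
  obtain q' where q': "q' \<in> conf n" "q' 0 = 1" "orbit n q' = orbit n q"
    using conf_normalize[OF assms(3)] .
  have pat: "same_pattern n p' q'"
    unfolding same_pattern_def
  proof (clarify)
    fix i j k assume ijk: "(i, j, k) \<in> triples n"
    have *: "ccw (spt p i) (spt p j) (spt p k) \<longleftrightarrow> ccw (spt q i) (spt q j) (spt q k)"
      using assms(4) ijk by (auto simp: same_pattern_def)
    show "ccw (spt p' i) (spt p' j) (spt p' k) \<longleftrightarrow> ccw (spt q' i) (spt q' j) (spt q' k)"
      using heaviside_orbit'[OF p'(1) ijk] heaviside_orbit'[OF q'(1) ijk]
        heaviside_orbit'[OF assms(2) ijk] heaviside_orbit'[OF assms(3) ijk] p'(3) q'(3) *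
      by (metis of_bool_eq_iff)
  qed
  define g where "g t = (\<lambda>i\<in>{..n}. cis ((1 - t) * Arg2pi (p' i) + t * Arg2pi (q' i)))" for t
  have g_conf: "g t \<in> conf n" if "t \<in> {0..1}" for t
    unfolding g_def using chamber_path_in_conf[OF p'(1,2) q'(1,2) pat] that by auto
  have "continuous_map (top_of_set {0..1}) (conf_space n) g"
    unfolding conf_space_def continuous_map_in_subtopology
  proof
    show "continuous_map (top_of_set {0..1}) (product_topology (\<lambda>_. top_of_set U1) {..n}) g"
      unfolding continuous_map_componentwise
    proof (intro conjI ballI)
      show "continuous_map (top_of_set {0..1}) (top_of_set U1) (\<lambda>t. g t k)" if "k \<in> {..n}" for k
        using that unfolding g_def
        by (auto simp: continuous_map_in_subtopology continuous_map_iff_continuous intro!: continuous_intros)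
    qed (auto simp: g_def)
  qed (use g_conf in auto)
  then have cont: "continuous_map (top_of_set {0..1}) (Y_space n) (orbit n \<circ> g)"
    unfolding Y_space_def
    by (rule continuous_map_compose) (intro quotient_imp_continuous_map quotient_map_quotient_topology)
  \<comment> \<open>Pulled back along the path, \<open>f\<close> is locally constant on a connected
    interval.\<close>
  have "(f \<circ> (orbit n \<circ> g)) constant_on {0..1}"
  proof (rule locally_constant_imp_constant)
    fix a :: real assume a: "a \<in> {0..1}"
    have "orbit n (g a) \<in> topspace (Y_space n)"
      using g_conf[OF a] by (simp add: topspace_Y_space)
    then obtain U where U: "openin (Y_space n) U" "orbit n (g a) \<in> U" "\<forall>y\<in>U. f y = f (orbit n (g a))"
      using f unfolding locally_constant_def by blast
    from openin_continuous_map_preimage[OF cont U(1)]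
    have "openin (top_of_set {0..1}) {x \<in> {0..1}. orbit n (g x) \<in> U}"
      by simp
    then show "\<exists>T. openin (top_of_set {0..1}) T \<and> a \<in> T \<and> (\<forall>x\<in>T. (f \<circ> (orbit n \<circ> g)) x = (f \<circ> (orbit n \<circ> g)) a)"
      unfolding comp_def using U(2,3) a by blast
  qed simp
  then have "f (orbit n (g 0)) = f (orbit n (g 1))"
    unfolding constant_on_def by auto
  moreover have "(\<lambda>i\<in>{..n}. cis (Arg2pi (r i))) = r" if "r \<in> conf n" for r
  proof
    fix i show "(\<lambda>i\<in>{..n}. cis (Arg2pi (r i))) i = r i"
      using that cis_Arg2pi[of "r i"] by (cases "i \<le> n") (auto simp: conf_def PiE_iff extensional_def)
  qed
  ultimately show ?thesis
    using p' q' by (simp add: g_def)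
qed

section \<open>The isomorphism\<close>

definition orbit_rep :: "nat \<Rightarrow> (nat \<Rightarrow> complex) set \<Rightarrow> nat \<Rightarrow> complex" where
  "orbit_rep n P = (SOME p. p \<in> conf n \<and> orbit n p = P)"

text \<open>Independence of the chosen representative is the content of
  \<open>heaviside_hom_orbit\<close>.\<close>

definition heaviside_hom :: "nat \<Rightarrow> yvar zpoly \<Rightarrow> (nat \<Rightarrow> complex) set \<Rightarrow> int" where
  "heaviside_hom n f = (\<lambda>P\<in>topspace (Y_space n). eval_at (orbit_rep n P) f)"

lemma orbit_rep:
  assumes "P \<in> topspace (Y_space n)"
  shows "orbit_rep n P \<in> conf n" "orbit n (orbit_rep n P) = P"
proof -
  have "\<exists>p. p \<in> conf n \<and> orbit n p = P"
    using assms by (auto simp: topspace_Y_space)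
  from someI_ex[OF this] show "orbit_rep n P \<in> conf n" "orbit n (orbit_rep n P) = P"
    by (auto simp: orbit_rep_def)
qed

lemma eval_at_heaviside_cong:
  assumes "f \<in> carrier (Zy n)" "p \<in> conf n" "q \<in> conf n"
    and "\<And>i j k. (i, j, k) \<in> triples n \<Longrightarrow>
      heaviside n i j k (orbit n p) = heaviside n i j k (orbit n q)"
  shows "eval_at p f = eval_at q f"
  unfolding eval_at_def
proof (rule peval_cong[OF assms(1)[unfolded Zy_def]])
  fix x assume "x \<in> {cyc i j k | i j k. (i, j, k) \<in> triples n}"
  then obtain i j k where "x = cyc i j k" "(i, j, k) \<in> triples n"
    by blast
  then show "ccw_val p x = ccw_val q x"
    using assms(4)[of i j k] heaviside_orbit'[OF assms(2)] heaviside_orbit'[OF assms(3)]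
    by (simp add: ccw_val_cyc)
qed

lemma heaviside_hom_orbit:
  assumes "f \<in> carrier (Zy n)" "p \<in> conf n"
  shows "heaviside_hom n f (orbit n p) = eval_at p f"
proof -
  have P: "orbit n p \<in> topspace (Y_space n)"
    using assms(2) by (simp add: topspace_Y_space)
  show ?thesis
    using eval_at_heaviside_cong[OF assms(1) orbit_rep(1)[OF P] assms(2)] P by (simp add: heaviside_hom_def orbit_rep(2))
qed

text \<open>On the open set where all Heaviside functions keep their values, every polynomial in
  them is constant.\<close>

lemma heaviside_hom_closed:
  assumes "f \<in> carrier (Zy n)"
  shows "heaviside_hom n f \<in> carrier (H_Y n)"
proof -
  have "locally_constant (Y_space n) (heaviside_hom n f)"
    unfolding locally_constant_def
  proof (intro ballI)
    fix P assume P: "P \<in> topspace (Y_space n)"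
    let ?U = "{Q \<in> topspace (Y_space n). \<forall>(i, j, k)\<in>triples n. heaviside n i j k Q = heaviside n i j k P}"
    have "heaviside_hom n f Q = heaviside_hom n f P" if "Q \<in> ?U" for Q
    proof -
      have Q: "Q \<in> topspace (Y_space n)"
        using that by simp
      have "eval_at (orbit_rep n Q) f = eval_at (orbit_rep n P) f"
        using that by (intro eval_at_heaviside_cong[OF assms orbit_rep(1)[OF Q] orbit_rep(1)[OF P]]) (auto simp: orbit_rep(2)[OF Q] orbit_rep(2)[OF P])
      then show ?thesis
        using P Q by (simp add: heaviside_hom_def)
    qed
    moreover have "P \<in> ?U"
      using P by simp
    ultimately show "\<exists>U. openin (Y_space n) U \<and> P \<in> U \<and> (\<forall>Q\<in>U. heaviside_hom n f Q = heaviside_hom n f P)"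
      using openin_heaviside_level[OF P] by blast
  qed
  then show ?thesis
    by (simp add: lc_ring_def heaviside_hom_def)
qed

lemma heaviside_hom_yv:
  assumes "(i, j, k) \<in> triples n"
  shows "heaviside_hom n (yv i j k) = heaviside n i j k"
proof (rule extensionalityI[of _ "topspace (Y_space n)"])
  fix P assume "P \<in> topspace (Y_space n)"
  then obtain p where "p \<in> conf n" "P = orbit n p"
    by (auto simp: topspace_Y_space)
  then show "heaviside_hom n (yv i j k) P = heaviside n i j k P"
    using assms by (simp add: heaviside_hom_orbit yv_carrier heaviside_orbit' eval_at_yv)
qed (auto simp: heaviside_hom_def heaviside_def)

lemma heaviside_hom_ring_hom: "ring_hom_ring (Zy n) (H_Y n) (heaviside_hom n)"
proof (rule ring_hom_ringI2)
  show "Ring.ring (Zy n)" "Ring.ring (H_Y n)"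
    using cring_Zy cring_lc_ring by (auto simp: cring_def)
  show "heaviside_hom n \<in> ring_hom (Zy n) (H_Y n)"
    by (rule ring_hom_memI) (auto simp: heaviside_hom_closed, auto simp: heaviside_hom_def lc_ring_def)
qed

lemma Zy_sum: "(\<And>x. x \<in> A \<Longrightarrow> F x \<in> carrier (Zy n)) \<Longrightarrow> (\<Sum>x\<in>A. F x) \<in> carrier (Zy n)"
  by (induction A rule: infinite_finite_induct) (simp_all add: Zy_closed)

lemma Zy_prod: "(\<And>x. x \<in> A \<Longrightarrow> F x \<in> carrier (Zy n)) \<Longrightarrow> (\<Prod>x\<in>A. F x) \<in> carrier (Zy n)"
  by (induction A rule: infinite_finite_induct) (simp_all add: Zy_closed)

text \<open>Interpolation over the finitely many patterns that occur: each indicator polynomial is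
  weighted with the value of \<open>f\<close> on its pattern, which
  \<open>locally_constant_same_pattern\<close> makes independent of the configuration.\<close>

lemma heaviside_hom_surj: "heaviside_hom n ` carrier (Zy n) = carrier (H_Y n)"
proof (intro equalityI subsetI)
  fix f assume f: "f \<in> carrier (H_Y n)"
  define pat where "pat p = {(i, j, k) \<in> triples n. ccw (spt p i) (spt p j) (spt p k)}" for p
  \<comment> \<open>The indicator polynomial of the pattern \<open>T\<close>, with a factor
    \<open>y\<close> for each triple in \<open>T\<close> and \<open>1 - y\<close> for each other
    triple.\<close>
  define e where "e T = (\<Prod>(i, j, k)\<in>triples n. if (i, j, k) \<in> T then yv i j k else 1 - yv i j k)" for T
  define r where "r T = (SOME p. p \<in> conf n \<and> pat p = T)" for T
  define g where "g = (\<Sum>T\<in>pat ` conf n. of_int (f (orbit n (r T))) * e T)"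
  have fin: "finite (pat ` conf n)"
    by (rule finite_subset[of _ "Pow (triples n)"]) (auto simp: pat_def finite_triples)
  have g: "g \<in> carrier (Zy n)"
    unfolding g_def e_def
    by (intro Zy_sum Zy_closed(6) of_int_Zy Zy_prod) (auto simp: Zy_closed yv_carrier)
  have ev_e: "eval_at p (e T) = of_bool (pat p = T)" if "T \<subseteq> triples n" for p T
  proof -
    have "eval_at p (e T) = (\<Prod>x\<in>triples n. of_bool (x \<in> pat p \<longleftrightarrow> x \<in> T))"
      unfolding e_def eval_at_simps by (intro prod.cong) (auto simp: eval_at_yv pat_def split: prod.splits)
    also have "\<dots> = of_bool (\<forall>x\<in>triples n. x \<in> pat p \<longleftrightarrow> x \<in> T)"
      using finite_triples[of n] by (induction rule: finite_induct) auto
    also have "(\<forall>x\<in>triples n. x \<in> pat p \<longleftrightarrow> x \<in> T) \<longleftrightarrow> pat p = T"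
      using that by (auto simp: pat_def)
    finally show ?thesis .
  qed
  have pat_sub: "pat q \<subseteq> triples n" for q
    by (auto simp: pat_def)
  have "eval_at p g = f (orbit n p)" if p: "p \<in> conf n" for p
  proof -
    have "eval_at p g = (\<Sum>T\<in>pat ` conf n. if T = pat p then f (orbit n (r T)) else 0)"
      unfolding g_def eval_at_simps by (intro sum.cong refl) (auto simp: ev_e[OF pat_sub])
    also have "\<dots> = f (orbit n (r (pat p)))"
      using p fin by simp
    also have "\<dots> = f (orbit n p)"
    proof (rule locally_constant_same_pattern)
      have "\<exists>q. q \<in> conf n \<and> pat q = pat p"
        using p by blast
      from someI_ex[OF this] have r: "r (pat p) \<in> conf n" "pat (r (pat p)) = pat p"
        by (auto simp: r_def)
      then show "r (pat p) \<in> conf n" by simp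
      show "same_pattern n (r (pat p)) p"
        using r(2) unfolding pat_def same_pattern_def by blast
    qed (use f p in \<open>auto simp: lc_ring_def\<close>)
    finally show ?thesis .
  qed
  then have "heaviside_hom n g = f"
    using g by (intro lc_ring_eqI[OF heaviside_hom_closed[OF g] f]) (auto simp: topspace_Y_space heaviside_hom_orbit)
  then show "f \<in> heaviside_hom n ` carrier (Zy n)"
    using g by blast
qed (auto intro: heaviside_hom_closed)

section \<open>The monomials as functions and the kernel of evaluation\<close>

lemma monoms_carrier: "m \<le> n \<Longrightarrow> monoms m \<subseteq> carrier (Zy n)"
proof (induction m)
  case (Suc m)
  then show ?case
    using hset_carrier[of "Suc m" n] by (auto simp: monoms_Suc intro!: Zy_closed)
qed (simp add: monoms_0 Zy_closed)

text \<open>Two codes of one monomial would give a relation with coefficients 1 and -1, against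
  independence of the codes.\<close>

lemma inj_on_basis_monom: "inj_on basis_monom (basis_index n)"
proof (rule inj_onI, rule ccontr)
  fix \<kappa> \<mu> assume *: "\<kappa> \<in> basis_index n" "\<mu> \<in> basis_index n" "basis_monom \<kappa> = basis_monom \<mu>" "\<kappa> \<noteq> \<mu>"
  have "(of_bool (\<kappa> = \<kappa>) - of_bool (\<kappa> = \<mu>) :: int) = 0"
  proof (rule basis_monom_indep[of n "\<lambda>\<nu>. of_bool (\<nu> = \<kappa>) - of_bool (\<nu> = \<mu>)"])
    fix p assume "p \<in> conf n"
    have "(\<Sum>\<nu>\<in>basis_index n. (of_bool (\<nu> = \<kappa>) - of_bool (\<nu> = \<mu>)) * eval_at p (basis_monom \<nu>)) =
        (\<Sum>\<nu>\<in>basis_index n. (if \<nu> = \<kappa> then eval_at p (basis_monom \<nu>) else 0)) - (\<Sum>\<nu>\<in>basis_index n. if \<nu> = \<mu> then eval_at p (basis_monom \<nu>) else 0)"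
      unfolding sum_subtractf[symmetric] by (intro sum.cong) auto
    also have "\<dots> = 0"
      using * by simp
    finally show "(\<Sum>\<nu>\<in>basis_index n. (of_bool (\<nu> = \<kappa>) - of_bool (\<nu> = \<mu>)) * eval_at p (basis_monom \<nu>)) = 0" .
  qed (fact *(1))
  then show False
    using *(4) by simp
qed

lemma monoms_indep:
  assumes "\<And>p. p \<in> conf n \<Longrightarrow> (\<Sum>b\<in>monoms n. c b * eval_at p b) = 0" "b \<in> monoms n"
  shows "c b = (0::int)"
proof -
  obtain \<kappa> where \<kappa>: "\<kappa> \<in> basis_index n" "b = basis_monom \<kappa>"
    using assms(2) by (auto simp flip: basis_monom_image)
  have "c (basis_monom \<kappa>) = 0"
    using assms(1) \<kappa>(1) inj_on_basis_monom
    by (intro basis_monom_indep[of n "\<lambda>\<kappa>. c (basis_monom \<kappa>)"]) (simp_all add: sum.reindex flip: basis_monom_image)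
  then show ?thesis
    by (simp add: \<kappa>)
qed

text \<open>The relations evaluate to 0, so the ideal lies in the kernel. Conversely, an element of
  the kernel is congruent to an integer combination of monomials that vanishes at every
  configuration, and \<open>monoms_indep\<close> makes all its coefficients 0.\<close>

lemma heaviside_hom_kernel: "a_kernel (Zy n) (H_Y n) (heaviside_hom n) = I_Y n"
proof -
  interpret ring_hom_ring "Zy n" "H_Y n" "heaviside_hom n"
    by (rule heaviside_hom_ring_hom)
  have ker: "f \<in> a_kernel (Zy n) (H_Y n) (heaviside_hom n) \<longleftrightarrow> f \<in> carrier (Zy n) \<and> (\<forall>p\<in>conf n. eval_at p f = 0)" for f
  proof (cases "f \<in> carrier (Zy n)")
    case True
    have "heaviside_hom n f = \<zero>\<^bsub>H_Y n\<^esub> \<longleftrightarrow> (\<forall>p\<in>conf n. eval_at p f = 0)"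
    proof
      assume eq: "heaviside_hom n f = \<zero>\<^bsub>H_Y n\<^esub>"
      show "\<forall>p\<in>conf n. eval_at p f = 0"
        using heaviside_hom_orbit[OF True] by (auto simp: eq lc_ring_def topspace_Y_space)
    next
      assume "\<forall>p\<in>conf n. eval_at p f = 0"
      then show "heaviside_hom n f = \<zero>\<^bsub>H_Y n\<^esub>"
        using orbit_rep(1) by (auto simp: heaviside_hom_def lc_ring_def)
    qed
    then show ?thesis
      unfolding a_kernel_def' using True by blast
  qed (unfold a_kernel_def', blast)
  have I: "I_Y n \<subseteq> a_kernel (Zy n) (H_Y n) (heaviside_hom n)"
    unfolding I_Y_def
  proof (rule R.genideal_minimal[OF kernel_is_ideal])
    show "relations n \<subseteq> a_kernel (Zy n) (H_Y n) (heaviside_hom n)"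
      using relations_carrier[of n] eval_at_relations[of _ n] by (auto simp: ker)
  qed
  moreover have "f \<in> I_Y n" if f: "f \<in> a_kernel (Zy n) (H_Y n) (heaviside_hom n)" for f
  proof -
    obtain c where c: "f - (\<Sum>b\<in>monoms n. of_int (c b) * b) \<in> I_Y n" (is "f - ?s \<in> _")
      using Zy_monoms[of f n] f by (auto simp: ker I_cong_def)
    have "c b = 0" if "b \<in> monoms n" for b
    proof (rule monoms_indep[OF _ that])
      fix p assume p: "p \<in> conf n"
      then have "eval_at p (f - ?s) = 0" "eval_at p f = 0"
        using I c f ker by blast+
      then show "(\<Sum>b\<in>monoms n. c b * eval_at p b) = 0"
        by simp
    qed
    then show ?thesis
      using c by simp
  qed
  ultimately show ?thesis
    by blast
qed

section \<open>Integer combinations of locally constant functions\<close>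

lemma lc_ring_add_pow:
  assumes "f \<in> carrier (lc_ring X)" "x \<in> topspace X"
  shows "([(k::int)] \<cdot>\<^bsub>lc_ring X\<^esub> f) x = k * f x"
proof -
  interpret cring "lc_ring X"
    by (rule cring_lc_ring)
  have nat: "([(m::nat)] \<cdot>\<^bsub>lc_ring X\<^esub> f) x = int m * f x" for m
  proof (induction m)
    case 0
    then show ?case
      using assms by (simp add: add_pow_def nat_pow_def lc_ring_simps)
  next
    case (Suc m)
    have "[Suc m] \<cdot>\<^bsub>lc_ring X\<^esub> f = [m] \<cdot>\<^bsub>lc_ring X\<^esub> f \<oplus>\<^bsub>lc_ring X\<^esub> f"
      by (simp add: add_pow_def nat_pow_def)
    then show ?case
      using Suc assms(2) by (simp add: lc_ring_simps algebra_simps)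
  qed
  have neg: "(\<ominus>\<^bsub>lc_ring X\<^esub> g) x = - g x" if "g \<in> carrier (lc_ring X)" for g
  proof -
    have "(g \<oplus>\<^bsub>lc_ring X\<^esub> (\<ominus>\<^bsub>lc_ring X\<^esub> g)) x = 0"
      using that assms(2) by (simp add: r_neg lc_ring_simps)
    then show ?thesis
      using assms(2) by (simp add: lc_ring_simps)
  qed
  show ?thesis
  proof (cases "k \<ge> 0")
    case True
    then show ?thesis
      by (simp add: add_pow_int_ge nat)
  next
    case False
    then show ?thesis
      using assms(1) by (simp add: add_pow_int_lt neg nat)
  qed
qed

lemma lc_ring_finsum:
  assumes "finite B" "\<And>b. b \<in> B \<Longrightarrow> F b \<in> carrier (lc_ring X)" "x \<in> topspace X"
  shows "(\<Oplus>\<^bsub>lc_ring X\<^esub>b\<in>B. F b) x = (\<Sum>b\<in>B. F b x)"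
proof -
  interpret cring "lc_ring X"
    by (rule cring_lc_ring)
  show ?thesis
    using assms(1,2)
  proof (induction B rule: finite_induct)
    case (insert b B)
    then have "(\<Oplus>\<^bsub>lc_ring X\<^esub>b\<in>insert b B. F b) = F b \<oplus>\<^bsub>lc_ring X\<^esub> (\<Oplus>\<^bsub>lc_ring X\<^esub>b\<in>B. F b)"
      by (intro finsum_insert) auto
    then show ?case
      using insert assms(3) by (simp add: lc_ring_simps)
  qed (simp add: assms(3) lc_ring_simps)
qed

text \<open>Reduces the basis property, phrased with ring sums and integer multiples, to pointwise
  identities of integers.\<close>

lemma lc_ring_combination_iff:
  fixes c :: "_ \<Rightarrow> int"
  assumes "finite B" "B \<subseteq> carrier (lc_ring X)" "f \<in> carrier (lc_ring X)"
  shows "f = (\<Oplus>\<^bsub>lc_ring X\<^esub>b\<in>B. [c b] \<cdot>\<^bsub>lc_ring X\<^esub> b) \<longleftrightarrow>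
    (\<forall>x\<in>topspace X. f x = (\<Sum>b\<in>B. c b * b x))" (is "f = ?s \<longleftrightarrow> _")
proof -
  interpret cring "lc_ring X"
    by (rule cring_lc_ring)
  have cl: "[c b] \<cdot>\<^bsub>lc_ring X\<^esub> b \<in> carrier (lc_ring X)" if "b \<in> B" for b
    using that assms(2) by (intro add.int_pow_closed) auto
  have "?s x = (\<Sum>b\<in>B. c b * b x)" if "x \<in> topspace X" for x
    using assms(1,2) cl that by (simp add: lc_ring_finsum lc_ring_add_pow subset_eq)
  moreover have "?s \<in> carrier (lc_ring X)"
    using cl by (intro finsum_closed) auto
  ultimately show ?thesis
    using lc_ring_eqI[OF assms(3)] by auto
qed

lemma inj_on_heaviside_hom_monoms: "inj_on (heaviside_hom n) (monoms n)"
proof (rule inj_onI, rule ccontr)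
  fix a b assume *: "a \<in> monoms n" "b \<in> monoms n" "heaviside_hom n a = heaviside_hom n b" "a \<noteq> b"
  have "(of_bool (a = a) - of_bool (a = b) :: int) = 0"
  proof (rule monoms_indep[of n "\<lambda>x. of_bool (x = a) - of_bool (x = b)"])
    fix p assume p: "p \<in> conf n"
    have "(\<Sum>x\<in>monoms n. (of_bool (x = a) - of_bool (x = b)) * eval_at p x) =
        (\<Sum>x\<in>monoms n. (if x = a then eval_at p x else 0)) - (\<Sum>x\<in>monoms n. if x = b then eval_at p x else 0)"
      unfolding sum_subtractf[symmetric] by (intro sum.cong) auto
    also have "\<dots> = eval_at p a - eval_at p b"
      using * finite_monoms by simp
    also have "\<dots> = 0"
      using * heaviside_hom_orbit[OF subsetD[OF monoms_carrier[OF order_refl] *(1)] p]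
        heaviside_hom_orbit[OF subsetD[OF monoms_carrier[OF order_refl] *(2)] p] by simp
    finally show "(\<Sum>x\<in>monoms n. (of_bool (x = a) - of_bool (x = b)) * eval_at p x) = 0" .
  qed (fact *(1))
  then show False
    using *(4) by simp
qed

text \<open>Existence: lift a function to a polynomial and reduce it modulo the ideal. Uniqueness:
  two coefficient systems differ by a relation between monomials.\<close>

lemma finite_Z_basis_heaviside_hom_monoms: "finite_Z_basis (H_Y n) (heaviside_hom n ` monoms n)"
  unfolding finite_Z_basis_def
proof (intro conjI ballI)
  let ?B = "heaviside_hom n ` monoms n"
  have mc: "b \<in> carrier (Zy n)" if "b \<in> monoms n" for b
    using that monoms_carrier[of n n] by blast
  show fin: "finite ?B" and B: "?B \<subseteq> carrier (H_Y n)"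
    using finite_monoms heaviside_hom_closed mc by auto
  have reindex: "(\<Sum>y\<in>?B. c y * y (orbit n p)) = (\<Sum>b\<in>monoms n. c (heaviside_hom n b) * eval_at p b)"
    if "p \<in> conf n" for c :: "_ \<Rightarrow> int" and p
    using that by (subst sum.reindex[OF inj_on_heaviside_hom_monoms]) (auto simp: heaviside_hom_orbit mc intro!: sum.cong)
  fix x assume x: "x \<in> carrier (H_Y n)"
  have eq: "x = (\<Oplus>\<^bsub>H_Y n\<^esub>b\<in>?B. [c b] \<cdot>\<^bsub>H_Y n\<^esub> b) \<longleftrightarrow>
      (\<forall>p\<in>conf n. x (orbit n p) = (\<Sum>b\<in>monoms n. c (heaviside_hom n b) * eval_at p b))" for c :: "_ \<Rightarrow> int"
    unfolding lc_ring_combination_iff[OF fin B x] topspace_Y_space using reindex by auto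
  show "\<exists>!c::_ \<Rightarrow> int. c \<in> extensional ?B \<and> x = (\<Oplus>\<^bsub>H_Y n\<^esub>b\<in>?B. [c b] \<cdot>\<^bsub>H_Y n\<^esub> b)"
  proof (rule ex_ex1I)
    obtain f where f: "f \<in> carrier (Zy n)" "x = heaviside_hom n f"
      using x heaviside_hom_surj by blast
    obtain d where d: "f - (\<Sum>b\<in>monoms n. of_int (d b) * b) \<in> I_Y n" (is "f - ?s \<in> _")
      using Zy_monoms[OF f(1)] by (auto simp: I_cong_def)
    \<comment> \<open>Coefficients are moved from the monomials to their images by injectivity; the
      restriction makes \<open>c\<close> extensional.\<close>
    define c where "c = (\<lambda>y\<in>?B. d (inv_into (monoms n) (heaviside_hom n) y))"
    have c: "c (heaviside_hom n b) = d b" if "b \<in> monoms n" for b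
      using that inv_into_f_f[OF inj_on_heaviside_hom_monoms that] by (simp add: c_def)
    have "x (orbit n p) = (\<Sum>b\<in>monoms n. c (heaviside_hom n b) * eval_at p b)" if p: "p \<in> conf n" for p
    proof -
      have "f - ?s \<in> carrier (Zy n)" "heaviside_hom n (f - ?s) = \<zero>\<^bsub>H_Y n\<^esub>"
        using d unfolding heaviside_hom_kernel[symmetric] a_kernel_def' by auto
      then have "eval_at p (f - ?s) = 0"
        using heaviside_hom_orbit[of "f - ?s" n p] p by (simp add: lc_ring_simps topspace_Y_space)
      then show ?thesis
        using f p c by (simp add: heaviside_hom_orbit)
    qed
    then have "x = (\<Oplus>\<^bsub>H_Y n\<^esub>b\<in>?B. [c b] \<cdot>\<^bsub>H_Y n\<^esub> b)"
      using eq[of c] by blast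
    moreover have "c \<in> extensional ?B"
      by (simp add: c_def)
    ultimately show "\<exists>c::_ \<Rightarrow> int. c \<in> extensional ?B \<and> x = (\<Oplus>\<^bsub>H_Y n\<^esub>b\<in>?B. [c b] \<cdot>\<^bsub>H_Y n\<^esub> b)"
      by blast
  next
    fix c d :: "_ \<Rightarrow> int"
    assume c: "c \<in> extensional ?B \<and> x = (\<Oplus>\<^bsub>H_Y n\<^esub>b\<in>?B. [c b] \<cdot>\<^bsub>H_Y n\<^esub> b)"
      and d: "d \<in> extensional ?B \<and> x = (\<Oplus>\<^bsub>H_Y n\<^esub>b\<in>?B. [d b] \<cdot>\<^bsub>H_Y n\<^esub> b)"
    have cd: "\<forall>p\<in>conf n. x (orbit n p) = (\<Sum>b\<in>monoms n. c (heaviside_hom n b) * eval_at p b)"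
      "\<forall>p\<in>conf n. x (orbit n p) = (\<Sum>b\<in>monoms n. d (heaviside_hom n b) * eval_at p b)"
      using iffD1[OF eq conjunct2[OF c]] iffD1[OF eq conjunct2[OF d]] .
    have "c (heaviside_hom n b) - d (heaviside_hom n b) = 0" if "b \<in> monoms n" for b
    proof (rule monoms_indep[of n "\<lambda>b. c (heaviside_hom n b) - d (heaviside_hom n b)", OF _ that])
      fix p assume p: "p \<in> conf n"
      show "(\<Sum>b\<in>monoms n. (c (heaviside_hom n b) - d (heaviside_hom n b)) * eval_at p b) = 0"
        using bspec[OF cd(1) p] bspec[OF cd(2) p] by (simp add: left_diff_distrib sum_subtractf)
    qed
    \<comment> \<open>Independence compares the two on the basis; extensionality settles all other
      arguments.\<close>
    then show "c = d"
      using conjunct1[OF c] conjunct1[OF d] by (intro extensionalityI[of c ?B d]) auto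
  qed
qed

theorem theorem3p7:
  fixes n :: nat
  shows "\<exists>\<phi>. \<phi> \<in> ring_iso (Zy n Quot I_Y n) (H_Y n) \<and>
     (\<forall>i j k. (i, j, k) \<in> triples n \<longrightarrow>
        \<phi> (I_Y n +>\<^bsub>Zy n\<^esub> yv i j k) = heaviside n i j k) \<and>
     inj_on (\<lambda>f. \<phi> (I_Y n +>\<^bsub>Zy n\<^esub> f)) (monoms n) \<and>
     finite_Z_basis (H_Y n) ((\<lambda>f. \<phi> (I_Y n +>\<^bsub>Zy n\<^esub> f)) ` monoms n)"
proof -
  interpret ring_hom_ring "Zy n" "H_Y n" "heaviside_hom n"
    by (rule heaviside_hom_ring_hom)
  \<comment> \<open>The map of the isomorphism theorem: \<open>heaviside_hom n\<close> is constant
    on each coset of its kernel, and \<open>the_elem\<close> extracts the common value.\<close>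
  define \<phi> where "\<phi> X = the_elem (heaviside_hom n ` X)" for X
  have iso: "\<phi> \<in> ring_iso (Zy n Quot I_Y n) (H_Y n)"
    using FactRing_iso_set[OF heaviside_hom_surj] by (simp add: heaviside_hom_kernel \<phi>_def[abs_def])
  have \<phi>: "\<phi> (I_Y n +>\<^bsub>Zy n\<^esub> f) = heaviside_hom n f" if "f \<in> carrier (Zy n)" for f
    using the_elem_simp[OF that] by (simp add: heaviside_hom_kernel \<phi>_def)
  have m: "\<phi> (I_Y n +>\<^bsub>Zy n\<^esub> f) = heaviside_hom n f" if "f \<in> monoms n" for f
    using that monoms_carrier[of n n] by (intro \<phi>) auto
  have "inj_on (\<lambda>f. \<phi> (I_Y n +>\<^bsub>Zy n\<^esub> f)) (monoms n)"
    using inj_on_heaviside_hom_monoms inj_on_cong[of "monoms n", OF m] by simp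
  moreover have "(\<lambda>f. \<phi> (I_Y n +>\<^bsub>Zy n\<^esub> f)) ` monoms n = heaviside_hom n ` monoms n"
    using m by (rule image_cong[OF refl])
  ultimately show ?thesis
    using iso \<phi>[OF yv_carrier] heaviside_hom_yv finite_Z_basis_heaviside_hom_monoms by (intro exI[of _ \<phi>]) auto
qed

end
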